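(* Let $r,d$ be positive integers. There is a constant $C=C(d,r)>0$ such that for every positive integer $n$ the following holds: if $H$ is an $r$-uniform semialgebraic hypergraph of description complexity $(d,2,1)$ on $N\ge \mathrm{tw}_{12}(Cn)$ vertices, then $H$ contains a clique or an independent set of size $n$.
   Context: The tower function: $\mathrm{tw}_1(x)=x$, $\mathrm{tw}_k(x)=2^{\mathrm{tw}_{k-1}(x)}$. For an ordered set $A$, $A^{(k)}=\{(a_1,\dots,a_k)\in A^k:a_1<\dots<a_k\}$. Semialgebraic hypergraph of description complexity $(d,D,m)$: let $V\subset\mathbb{R}^d$ be a finite totally ordered set, $f_1,\dots,f_m:(\mathbb{R}^d)^r\to\mathbb{R}$ polynomials of total degree at most $D$, and $\Gamma:\{\texttt{false},\texttt{true}\}^m\to\{\texttt{false},\texttt{true}\}$ a Boolean formula; the $r$-uniform hypergraph on $V$ in which $x\in V^{(r)}$ is an edge iff $\Gamma(f_1(x)\le0,\dots,f_m(x)\le0)=\texttt{true}$, and any hypergraph isomorphic to it, is semialgebraic of description complexity $(d,D,m)$. A clique is a vertex set all of whose $r$-subsets are edges; an independent set contains no edge. *)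

theory Defs
  imports Complex_Main
begin

fun tw :: "nat \<Rightarrow> real \<Rightarrow> real" where
  "tw 0 x = x"
| "tw (Suc 0) x = x"
| "tw (Suc (Suc k)) x = 2 powr (tw (Suc k) x)"

text \<open>A real polynomial of total degree at most 2 in the variables z k j
  (k < r indexes the point, j < d the coordinate), written out explicitly
  with coefficients A (quadratic), B (linear), c (constant).\<close>
definition quad_poly ::
  "nat \<Rightarrow> nat \<Rightarrow> (nat \<Rightarrow> nat \<Rightarrow> nat \<Rightarrow> nat \<Rightarrow> real) \<Rightarrow> (nat \<Rightarrow> nat \<Rightarrow> real) \<Rightarrow> real
    \<Rightarrow> (nat \<Rightarrow> nat \<Rightarrow> real) \<Rightarrow> real" where
  "quad_poly d r A B c z =
     (\<Sum>k<r. \<Sum>j<d. \<Sum>k'<r. \<Sum>j'<d. A k j k' j' * z k j * z k' j')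
     + (\<Sum>k<r. \<Sum>j<d. B k j * z k j) + c"

definition incr_tuple :: "nat \<Rightarrow> nat set \<Rightarrow> (nat \<Rightarrow> nat) \<Rightarrow> bool" where
  "incr_tuple r S t \<longleftrightarrow> (\<forall>k<r. t k \<in> S) \<and> (\<forall>k. Suc k < r \<longrightarrow> t k < t (Suc k))"

text \<open>Semialgebraic r-uniform hypergraph of description complexity (d,2,1):
  vertex set {..<N} (ordered by index), vertex i is the point p i in R^d
  (coordinates p i j, j < d), one polynomial f of degree \<le> 2, Boolean formula
  \<Gamma> in one variable. Edges are the sets {t 0,...,t (r-1)} with t increasing and
  \<Gamma>(f(p (t 0),...,p (t (r-1))) \<le> 0).\<close>
definition sa_edges ::
  "nat \<Rightarrow> nat \<Rightarrow> nat \<Rightarrow> (nat \<Rightarrow> nat \<Rightarrow> real) \<Rightarrow> (nat \<Rightarrow> nat \<Rightarrow> nat \<Rightarrow> nat \<Rightarrow> real)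
    \<Rightarrow> (nat \<Rightarrow> nat \<Rightarrow> real) \<Rightarrow> real \<Rightarrow> (bool \<Rightarrow> bool) \<Rightarrow> nat set set" where
  "sa_edges d r N p A B c \<Gamma> =
     {e. \<exists>t. incr_tuple r {..<N} t \<and> e = t ` {..<r}
            \<and> \<Gamma> (quad_poly d r A B c (\<lambda>k j. p (t k) j) \<le> 0)}"

definition is_clique :: "nat \<Rightarrow> nat set set \<Rightarrow> nat set \<Rightarrow> bool" where
  "is_clique r E S \<longleftrightarrow> (\<forall>e. e \<subseteq> S \<and> card e = r \<longrightarrow> e \<in> E)"

definition is_indep :: "nat \<Rightarrow> nat set set \<Rightarrow> nat set \<Rightarrow> bool" where
  "is_indep r E S \<longleftrightarrow> (\<forall>e. e \<subseteq> S \<and> card e = r \<longrightarrow> e \<notin> E)"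

end

(*
  Only the shape F(t) = sum_{k<l} g_kl(t_k, t_l) + sum_k h_k(t_k) + c of a quadratic polynomial
  matters; the dimension plays no role. By Ramsey's theorem for 5-tuples we may assume that the
  second differences of every g_kl have constant sign and, in each variable separately, grow or
  shrink at least geometrically. Summing the unit second differences from the side on which they
  are small gives g_kl(i, j) = A(i) + B(j) + T(i, j) where T changes by large factors when either
  variable moves. Absorbing A and B into the h_k, Ramsey for 3-tuples does the same for the
  one-variable terms. Finally Ramsey for 4-tuples makes the comparison, up to a factor M, of any two
  of the M remaining terms independent of t. Two terms have different sets of variables, and moving
  a variable of only one of them changes their ratio by more than M^2, so they cannot be comparable;
  hence one term always dominates the sum and determines its sign. Ramsey for k-tuples costs
  k - 1 exponentials, provided the tower has height at least 2 already; the three applications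
  give height 2 + 4 + 2 + 3 = 11.
*)
theory Submission
  imports Defs "HOL-Library.FuncSet"
begin

section \<open>Ramsey for increasing lists\<close>

text \<open>Geometric growth comes from a feature of Ramsey homogeneity: adjacent intervals are
  compared at every length, not only at unit length. So the increment over the whole past is at most
  the increment over the next unit interval, and partial sums at least double at each step (or the
  mirror image holds). For a second difference this takes three points in the compared variable and
  two in the other, which is where the 5-tuples come from; 4-tuples appear at the end because two
  terms together involve at most four positions. The obstacle is that \<open>g i j\<close> is
  controlled only for \<open>i < j\<close>. Unit boxes that touch the diagonal have to be discarded,
  so doubling is missing for rows and columns near it. This costs a factor 2 in the variation of
  \<open>T\<close>, and additivity of the remainder can be tested only on boxes above the diagonal.
  Both losses are repaired by spacing: only every \<open>L\<close>-th index is kept, with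
  \<open>2 ^ L\<close> larger than twice the square of the number of terms.\<close>

definition incs :: "nat set \<Rightarrow> nat \<Rightarrow> nat list set" where
  "incs H k = {ys. length ys = k \<and> sorted_wrt (<) ys \<and> set ys \<subseteq> H}"

lemma large_fibre:
  assumes "finite S" "finite R" "f ` S \<subseteq> R" "card R \<le> K"
  shows "\<exists>v. card S \<le> K * card {y \<in> S. f y = v}"
proof (cases "S = {}")
  case False
  then have "R \<noteq> {}" using assms(3) by auto
  then obtain v where "card S \<le> card (f -` {v} \<inter> S) * card R"
    using pigeonhole_card[of f S R] assms by auto
  also have "f -` {v} \<inter> S = {y \<in> S. f y = v}" by auto
  also have "card {y \<in> S. f y = v} * card R \<le> K * card {y \<in> S. f y = v}"
    using assms(4) by (simp add: mult.commute)
  finally show ?thesis by blast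
qed simp

lemma card_incs_le:
  assumes "finite E"
  shows "finite (incs E k)" "card (incs E k) \<le> card E ^ k"
proof -
  have sub: "incs E k \<subseteq> {xs. set xs \<subseteq> E \<and> length xs = k}" by (auto simp: incs_def)
  show "finite (incs E k)"
    using finite_subset[OF sub] finite_lists_length_eq[OF assms] by auto
  show "card (incs E k) \<le> card E ^ k"
    using card_mono[OF finite_lists_length_eq[OF assms] sub] card_lists_length_eq[OF assms] by metis
qed

text \<open>The Erdos--Rado step: with \<open>S\<close> empty, the colour of a \<open>(k + 1)\<close>-list does not depend
  on its last entry. The reservoir \<open>S\<close> contains the candidates for further elements.\<close>

definition end_agree :: "(nat list \<Rightarrow> 'c) \<Rightarrow> nat \<Rightarrow> nat set \<Rightarrow> nat set \<Rightarrow> bool" where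
  "end_agree c k E S \<longleftrightarrow> (\<forall>ys\<in>incs E k. \<forall>y\<in>E \<union> S. \<forall>y'\<in>E \<union> S.
     (\<forall>z\<in>set ys. z < y \<and> z < y') \<longrightarrow> c (ys @ [y]) = c (ys @ [y']))"

text \<open>Each round moves the least reservoir element \<open>s\<close> into \<open>E\<close> and
  keeps those reservoir elements that give the same colours behind all \<open>k\<close>-lists of the
  enlarged \<open>E\<close>. Since \<open>E\<close> never exceeds \<open>m\<close> elements, there
  are at most \<open>q ^ (m ^ k)\<close> colour patterns, and a factor \<open>K + 1\<close> per
  round pays for both \<open>s\<close> and the pigeonhole.\<close>

lemma end_agree_extend:
  fixes c :: "nat list \<Rightarrow> 'c"
  assumes Q: "finite Q" "card Q \<le> q" "q > 0" "\<And>ys. c ys \<in> Q"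
    and K: "K = q ^ (m ^ k)"
  shows "finite E \<Longrightarrow> finite S \<Longrightarrow> (\<forall>x\<in>E. \<forall>y\<in>S. x < y) \<Longrightarrow> card E + i \<le> m \<Longrightarrow>
    (K + 1) ^ i \<le> card S \<Longrightarrow> end_agree c k E S \<Longrightarrow>
    \<exists>E'\<subseteq>E \<union> S. card E' = card E + i \<and> end_agree c k E' {}"
proof (induction i arbitrary: E S)
  case 0
  then show ?case by (intro exI[of _ E]) (auto simp: end_agree_def)
next
  case (Suc i)
  have "card S \<noteq> 0" using Suc.prems(5) by (intro notI) simp
  then have "S \<noteq> {}" by auto
  define s where "s = Min S"
  have s: "s \<in> S" "\<And>y. y \<in> S \<Longrightarrow> s \<le> y"
    using \<open>S \<noteq> {}\<close> Suc.prems(2) by (auto simp: s_def)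
  define E1 where "E1 = insert s E"
  have finE1: "finite E1" using Suc.prems by (simp add: E1_def)
  have "s \<notin> E" using s Suc.prems(3) by auto
  then have cE1: "card E1 = card E + 1" using Suc.prems by (simp add: E1_def)
  define L where "L = incs E1 k"
  have L: "finite L" "card L \<le> m ^ k"
  proof -
    have "card L \<le> card E1 ^ k" unfolding L_def by (rule card_incs_le(2)[OF finE1])
    also have "\<dots> \<le> m ^ k" using cE1 Suc.prems(4) by (intro power_mono) auto
    finally show "card L \<le> m ^ k" .
  qed (simp add: L_def card_incs_le finE1)
  define f where "f y = (\<lambda>ys\<in>L. c (ys @ [y]))" for y
  have img: "f ` (S - {s}) \<subseteq> (\<Pi>\<^sub>E ys\<in>L. Q)" using Q(4) by (auto simp: f_def)
  have cR: "card (\<Pi>\<^sub>E ys\<in>L. Q) \<le> K"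
  proof -
    have "card (\<Pi>\<^sub>E ys\<in>L. Q) = card Q ^ card L" using L(1) by (simp add: card_PiE)
    also have "\<dots> \<le> q ^ card L" using Q(2) by (simp add: power_mono)
    also have "\<dots> \<le> K" unfolding K using L(2) Q(3) by (intro power_increasing) auto
    finally show ?thesis .
  qed
  obtain v where v: "card (S - {s}) \<le> K * card {y \<in> S - {s}. f y = v}"
    using large_fibre[OF _ _ img cR] Suc.prems(2) L(1) Q K by (auto intro: finite_PiE)
  define S1 where "S1 = {y \<in> S - {s}. f y = v}"
  have S1: "(K + 1) ^ i \<le> card S1"
  proof (rule ccontr)
    assume "\<not> ?thesis"
    then have "card S1 < (K + 1) ^ i" by simp
    then have "K * card S1 + card S1 < (K + 1) ^ Suc i"
      by (metis add.commute Suc_eq_plus1 mult.commute mult_Suc mult_less_cancel2 power_Suc2 zero_less_Suc)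
    moreover have "card S \<le> K * card S1 + 1"
      using v s Suc.prems(2) unfolding S1_def by simp
    moreover have "K * card S1 + K \<le> K * (K + 1) ^ i"
      using mult_le_mono2[OF Suc_leI[OF \<open>card S1 < (K + 1) ^ i\<close>], of K] by simp
    moreover have "(K + 1) ^ Suc i = K * (K + 1) ^ i + (K + 1) ^ i" by simp
    moreover have "K > 0" using K Q(3) by simp
    moreover have "(K + 1) ^ i \<ge> 1" by simp
    ultimately show False using Suc.prems(5) by linarith
  qed
  have "end_agree c k E1 S1"
    unfolding end_agree_def
  proof (intro ballI impI)
    fix ys y y'
    assume ys: "ys \<in> incs E1 k" and y: "y \<in> E1 \<union> S1" "y' \<in> E1 \<union> S1"
      and lt: "\<forall>z\<in>set ys. z < y \<and> z < y'"
    have yS: "y \<in> E \<union> S" "y' \<in> E \<union> S" using y s by (auto simp: E1_def S1_def)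
    show "c (ys @ [y]) = c (ys @ [y'])"
    \<comment> \<open>Only lists through \<open>s\<close> are new. Behind them \<open>y\<close> and
      \<open>y'\<close> exceed \<open>s\<close>, hence lie in \<open>S1\<close>, because everything
      in \<open>E\<close> is below \<open>s\<close>.\<close>
    proof (cases "s \<in> set ys")
      case False
      then have "ys \<in> incs E k" using ys by (auto simp: incs_def E1_def)
      then show ?thesis using Suc.prems(6) yS lt unfolding end_agree_def by blast
    next
      case True
      then have "s < y" "s < y'" using lt by auto
      then have "y \<in> S1" "y' \<in> S1" using y Suc.prems(3) s(1) by (auto simp: E1_def dest: less_asym)
      then have "f y = f y'" by (auto simp: S1_def)
      then have "f y ys = f y' ys" by simp
      then show ?thesis using ys by (simp add: f_def L_def)
    qed
  qed
  then obtain E' where E': "E' \<subseteq> E1 \<union> S1" "card E' = card E1 + i" "end_agree c k E' {}"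
    using Suc.IH[of E1 S1] finE1 Suc.prems S1 cE1 s by (auto simp: E1_def S1_def order_less_le)
  then show ?case using cE1 s by (intro exI[of _ E']) (auto simp: E1_def S1_def)
qed

text \<open>The index \<open>k\<close> belongs to lists of length \<open>k + 1\<close>. With
  \<open>m = ramsey_bound q k n + 1\<close> and \<open>K = q ^ (m ^ (k + 1))\<close>, the recursive
  value is an upper estimate of the reservoir size \<open>(K + 1) ^ m\<close>, using
  \<open>q \<le> 2 ^ q\<close>. The extra element in \<open>m\<close> is the maximum that serves as
  common last entry.\<close>

fun ramsey_bound :: "nat \<Rightarrow> nat \<Rightarrow> nat \<Rightarrow> nat" where
  "ramsey_bound q 0 n = q * n"
| "ramsey_bound q (Suc k) n = 2 ^ ((q + 1) * (ramsey_bound q k n + 1) ^ (k + 2))"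

lemma ramsey_sets:
  fixes c :: "nat list \<Rightarrow> 'c"
  assumes Q: "finite Q" "card Q \<le> q" "q > 0"
  shows "(\<And>ys. c ys \<in> Q) \<Longrightarrow> finite S \<Longrightarrow> ramsey_bound q k n \<le> card S \<Longrightarrow>
    \<exists>H\<subseteq>S. card H = n \<and> (\<exists>v. \<forall>ys\<in>incs H (Suc k). c ys = v)"
proof (induction k arbitrary: c S)
  case 0
  obtain v where v: "card S \<le> q * card {y \<in> S. c [y] = v}"
    using large_fibre[OF 0(2) Q(1) _ Q(2), of "\<lambda>y. c [y]"] 0(1) by auto
  then have "n \<le> card {y \<in> S. c [y] = v}"
    using 0(3) Q(3) by (metis le_trans mult_le_cancel1 ramsey_bound.simps(1) nat_less_le)
  then obtain H where H: "H \<subseteq> {y \<in> S. c [y] = v}" "card H = n"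
    by (meson obtain_subset_with_card_n)
  have "c ys = v" if "ys \<in> incs H (Suc 0)" for ys
    using that H(1) by (auto simp: incs_def length_Suc_conv)
  moreover have "H \<subseteq> S" using H(1) by auto
  ultimately show ?case using H(2) by auto
next
  case (Suc k)
  define m where "m = ramsey_bound q k n + 1"
  define K where "K = q ^ (m ^ Suc k)"
  have big: "(K + 1) ^ m \<le> card S"
  proof -
    have "q \<le> 2 ^ q" using less_exp[of q] by simp
    then have "K \<le> 2 ^ (q * m ^ Suc k)"
      unfolding K_def power_mult by (rule power_mono) simp
    moreover have "(1::nat) \<le> 2 ^ (q * m ^ Suc k)" by (rule one_le_power) simp
    ultimately have "K + 1 \<le> 2 ^ (q * m ^ Suc k + 1)"
      unfolding power_add power_one_right by linarith
    then have "(K + 1) ^ m \<le> (2 ^ (q * m ^ Suc k + 1)) ^ m" by (rule power_mono) simp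
    also have "\<dots> = 2 ^ ((q * m ^ Suc k + 1) * m)" by (rule power_mult[symmetric])
    also have "\<dots> \<le> 2 ^ ((q + 1) * m ^ (k + 2))"
    proof (rule power_increasing)
      have "m ^ Suc k \<ge> 1" unfolding m_def by (rule one_le_power) simp
      then have "(q * m ^ Suc k + 1) * m \<le> (q * m ^ Suc k + m ^ Suc k) * m" by (intro mult_le_mono1) simp
      then show "(q * m ^ Suc k + 1) * m \<le> (q + 1) * m ^ (k + 2)" by (simp add: algebra_simps)
    qed simp
    also have "\<dots> \<le> card S" using Suc.prems(3) by (simp add: m_def)
    finally show ?thesis .
  qed
  obtain E where E: "E \<subseteq> S" "card E = m" "end_agree c (Suc k) E {}"
    using end_agree_extend[OF Q _ K_def, of c "{}" S m] Suc.prems(1,2) big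
    by (auto simp: end_agree_def incs_def)
  have finE: "finite E" using E(1) Suc.prems(2) finite_subset by blast
  have neE: "E \<noteq> {}" using E(2) by (auto simp: m_def)
  \<comment> \<open>Colours of lists from \<open>E\<close> ignore the last entry, so it may be
    replaced by the maximum \<open>w\<close>. This induces a colouring of lists one shorter on
    \<open>E - {w}\<close>.\<close>
  define w where "w = Max E"
  have w: "w \<in> E" "\<And>y. y \<in> E \<Longrightarrow> y \<le> w" using finE neE by (auto simp: w_def)
  have "ramsey_bound q k n \<le> card (E - {w})" using E(2) w finE by (simp add: m_def)
  then obtain H v where H: "H \<subseteq> E - {w}" "card H = n"
    and v: "\<And>ys. ys \<in> incs H (Suc k) \<Longrightarrow> c (ys @ [w]) = v"
    using Suc.IH[of "\<lambda>ys. c (ys @ [w])" "E - {w}"] Suc.prems(1) finE by auto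
  have "c zs = v" if zs: "zs \<in> incs H (Suc (Suc k))" for zs
  proof -
    obtain ys y where zy: "zs = ys @ [y]" using zs
      by (auto simp: incs_def) (metis length_Suc_conv_rev)
    then have ys: "ys \<in> incs H (Suc k)" and y: "y \<in> H" and lt: "\<forall>z\<in>set ys. z < y"
      using zs by (auto simp: incs_def sorted_wrt_append)
    have "\<forall>z\<in>set ys. z < w" using ys H(1) w(2) by (force simp: incs_def order_less_le)
    moreover have "ys \<in> incs E (Suc k)" using ys H(1) by (auto simp: incs_def)
    ultimately have "c (ys @ [y]) = c (ys @ [w])"
      using E(3) y H(1) w(1) lt unfolding end_agree_def by blast
    then show ?thesis using v[OF ys] zy by simp
  qed
  moreover have "H \<subseteq> S" using H(1) E(1) by auto
  ultimately show ?case using H(2) by auto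
qed

text \<open>A single colouring treats all lengths \<open>u \<le> k + 1\<close>: the colour of a list
  records which predicates hold on which of its prefixes, so \<open>q\<close> counts the subsets of
  \<open>I \<times> {..k+1}\<close>. Shorter lists are padded with elements from position
  \<open>n\<close> on, for which \<open>k + 1\<close> additional elements are reserved.\<close>

lemma ramsey_family:
  fixes P :: "'i \<Rightarrow> nat list \<Rightarrow> bool"
  assumes "finite I" and q: "q = 2 ^ (card I * (k + 2))"
    and N: "ramsey_bound q k (n + k + 1) \<le> N"
  shows "\<exists>x. strict_mono_on {..<n} x \<and> x ` {..<n} \<subseteq> {..<N} \<and>
    (\<forall>i\<in>I. \<forall>u\<le>k+1. (\<forall>ys\<in>incs {..<n} u. P i (map x ys)) \<or> (\<forall>ys\<in>incs {..<n} u. \<not> P i (map x ys)))"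
proof -
  define c where "c ys = {(i, u). i \<in> I \<and> u \<le> k + 1 \<and> P i (take u ys)}" for ys
  define Q where "Q = Pow (I \<times> {..k+1})"
  have Q: "finite Q" "card Q \<le> q" "q > 0" "\<And>ys. c ys \<in> Q"
    using assms(1) by (auto simp: Q_def c_def q card_Pow)
  obtain H v where H: "H \<subseteq> {..<N}" "card H = n + k + 1"
    and v: "\<And>ys. ys \<in> incs H (Suc k) \<Longrightarrow> c ys = v"
    using ramsey_sets[OF Q(1-3), of c "{..<N}" k "n + k + 1"] Q(4) N by auto
  have finH: "finite H" using H(1) finite_subset by blast
  define x where "x = (!) (sorted_list_of_set H)"
  have mono: "x i < x j" if "i < j" "j < n + k + 1" for i j
    unfolding x_def using that H(2)
    by (intro sorted_wrt_nth_less[of "(<)"]) (auto simp: strict_sorted_list_of_set)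
  have xH: "x i \<in> H" if "i < n + k + 1" for i
    unfolding x_def using that H(2) finH
    by (metis length_sorted_list_of_set nth_mem set_sorted_list_of_set)
  define pad where "pad ys = map x (ys @ [n..<n + (k + 1 - length ys)])" for ys
  have pad: "pad ys \<in> incs H (Suc k)" "take u (pad ys) = map x ys"
    if "ys \<in> incs {..<n} u" "u \<le> k + 1" for ys u
  proof -
    have len: "length ys = u" and set: "set ys \<subseteq> {..<n}" and so: "sorted_wrt (<) ys"
      using that by (auto simp: incs_def)
    show "take u (pad ys) = map x ys" using len by (simp add: pad_def)
    have "sorted_wrt (<) (ys @ [n..<n + (k + 1 - length ys)])"
      using so set by (auto simp: sorted_wrt_append)
    then have "sorted_wrt (<) (pad ys)"
      unfolding pad_def sorted_wrt_map
      by (rule sorted_wrt_mono_rel[rotated]) (use set in \<open>auto intro!: mono\<close>)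
    moreover have "set (pad ys) \<subseteq> H" using set by (auto simp: pad_def intro!: xH)
    ultimately show "pad ys \<in> incs H (Suc k)"
      using len that(2) by (auto simp: incs_def pad_def)
  qed
  have "P i (map x ys) = P i (map x zs)"
    if "i \<in> I" "u \<le> k + 1" "ys \<in> incs {..<n} u" "zs \<in> incs {..<n} u" for i u ys zs
  proof -
    have "c (pad ys) = c (pad zs)" using v pad(1) that by metis
    then have "(i, u) \<in> c (pad ys) \<longleftrightarrow> (i, u) \<in> c (pad zs)" by simp
    then show ?thesis using that pad(2)[OF that(3,2)] pad(2)[OF that(4,2)] by (simp add: c_def)
  qed
  moreover have "strict_mono_on {..<n} x" by (auto intro!: strict_mono_onI mono)
  moreover have "x ` {..<n} \<subseteq> {..<N}"
  proof (rule image_subsetI)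
    fix i assume "i \<in> {..<n}"
    then show "x i \<in> {..<N}" using xH[of i] H(1) by auto
  qed
  ultimately show ?thesis by blast
qed

section \<open>Tower-type bounds\<close>

definition tower_bounded :: "nat \<Rightarrow> (nat \<Rightarrow> nat) \<Rightarrow> bool" where
  "tower_bounded j f \<longleftrightarrow> (\<exists>a::nat. a > 0 \<and> (\<forall>n>0. real (f n) \<le> tw j (real (a * n))))"

lemma tw_Suc: "j > 0 \<Longrightarrow> tw (Suc j) x = 2 powr tw j x"
  by (cases j) auto

lemma le_two_powr: "(x::real) \<le> 2 powr x"
proof (cases "x \<ge> 0")
  case True
  then have "x < real (nat \<lfloor>x\<rfloor> + 1)" by linarith
  also have "real (nat \<lfloor>x\<rfloor> + 1) \<le> 2 ^ nat \<lfloor>x\<rfloor>"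
    using less_exp[of "nat \<lfloor>x\<rfloor>"] by (metis Suc_eq_plus1 Suc_leI of_nat_le_iff of_nat_numeral of_nat_power)
  also have "\<dots> = 2 powr real (nat \<lfloor>x\<rfloor>)" by (simp add: powr_realpow)
  also have "\<dots> \<le> 2 powr x" using True by simp
  finally show ?thesis by simp
next
  case False
  then show ?thesis by (smt (verit) powr_ge_zero)
qed

lemma tw_ge_one: "1 \<le> x \<Longrightarrow> 1 \<le> tw j x"
proof (induction j x rule: tw.induct)
  case (3 k x)
  then show ?case using le_two_powr[of "tw (Suc k) x"] by simp
qed auto

text \<open>For \<open>a \<ge> 1\<close> and \<open>y \<ge> 1\<close> one has
  \<open>a \<le> 2 powr ((a - 1) * y)\<close>, so each exponential hands the factor \<open>a\<close>
  on to its exponent. All later constants are absorbed into the innermost one in this way.\<close>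

lemma tw_scale:
  assumes "1 \<le> x"
  shows "real a * tw j x \<le> tw j (real a * x)"
  using assms
proof (induction j x rule: tw.induct)
  case (3 k x)
  define y where "y = tw (Suc k) x"
  have y: "y \<ge> 1" unfolding y_def using 3 by (intro tw_ge_one)
  show ?case
  proof (cases "a = 0")
    case False
    have "real a \<le> 2 ^ (a - 1)"
      using less_exp[of "a - 1"] False
      by (metis One_nat_def Suc_leI Suc_pred neq0_conv of_nat_le_iff of_nat_numeral of_nat_power)
    also have "\<dots> = 2 powr (real a - 1)" using False by (simp add: powr_realpow of_nat_diff flip: powr_realpow)
    also have "\<dots> \<le> 2 powr ((real a - 1) * y)"
      using False y by (intro powr_mono) (auto simp: mult_le_cancel_left1)
    finally have "real a * 2 powr y \<le> 2 powr ((real a - 1) * y) * 2 powr y"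
      by (intro mult_right_mono) auto
    also have "\<dots> = 2 powr (real a * y)" by (simp add: algebra_simps flip: powr_add)
    also have "\<dots> \<le> 2 powr (tw (Suc k) (real a * x))"
      using 3 by (simp add: y_def)
    finally show ?thesis by (simp add: y_def)
  qed simp
qed auto

lemma tower_bounded_mono:
  assumes "tower_bounded j g" "\<And>n. n > 0 \<Longrightarrow> f n \<le> g n"
  shows "tower_bounded j f"
  using assms unfolding tower_bounded_def by (meson of_nat_le_iff order_trans)

lemma tower_bounded_linear:
  assumes "tower_bounded j f"
  shows "tower_bounded j (\<lambda>n. a * f n + b)"
proof -
  obtain C where C: "C > 0" "\<And>n. n > 0 \<Longrightarrow> real (f n) \<le> tw j (real (C * n))"
    using assms by (auto simp: tower_bounded_def)
  have "real (a * f n + b) \<le> tw j (real ((a + b + 1) * C * n))" if "n > 0" for n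
  proof -
    have "1 \<le> C * n" using that C(1) by (metis One_nat_def Suc_leI nat_0_less_mult_iff)
    then have one: "1 \<le> real (C * n)" by linarith
    have "real (a * f n + b) \<le> real a * tw j (real (C * n)) + real b * tw j (real (C * n))"
      using C(2)[OF that] tw_ge_one[OF one, of j]
      by (auto intro!: add_mono mult_left_mono simp: mult_le_cancel_left1)
    also have "\<dots> \<le> real (a + b + 1) * tw j (real (C * n))"
      using tw_ge_one[OF one, of j] by (simp add: algebra_simps)
    also have "\<dots> \<le> tw j (real (a + b + 1) * real (C * n))" by (rule tw_scale[OF one])
    finally show ?thesis by (simp only: of_nat_mult mult.assoc)
  qed
  then show ?thesis using C(1) unfolding tower_bounded_def
    by (intro exI[of _ "(a + b + 1) * C"]) auto
qed

lemma tower_bounded_exp: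
  assumes "tower_bounded j f" "j > 0"
  shows "tower_bounded (Suc j) (\<lambda>n. 2 ^ f n)"
  using assms unfolding tower_bounded_def
  by (auto simp: tw_Suc simp flip: powr_realpow)

lemma tower_bounded_Suc:
  assumes "tower_bounded j f" "j > 0"
  shows "tower_bounded (Suc j) f"
  by (rule tower_bounded_mono[OF tower_bounded_exp[OF assms]]) (simp add: less_imp_le)

text \<open>A power of an exponential only multiplies its exponent, and \<open>tw_scale\<close>
  absorbs that. At height 1 a power of a linear bound is no longer linear, hence
  \<open>j > 0\<close>.\<close>

lemma tower_bounded_power:
  assumes "tower_bounded (Suc j) f" "j > 0"
  shows "tower_bounded (Suc j) (\<lambda>n. f n ^ a)"
proof -
  obtain C where C: "C > 0" "\<And>n. n > 0 \<Longrightarrow> real (f n) \<le> tw (Suc j) (real (C * n))"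
    using assms by (auto simp: tower_bounded_def)
  have "real (f n ^ a) \<le> tw (Suc j) (real ((a + 1) * C * n))" if "n > 0" for n
  proof -
    have "1 \<le> C * n" using that C(1) by (metis One_nat_def Suc_leI nat_0_less_mult_iff)
    then have one: "1 \<le> real (C * n)" by linarith
    have "real (f n ^ a) \<le> (2 powr tw j (real (C * n))) ^ a"
      using C(2)[OF that] assms(2) by (auto simp: tw_Suc intro: power_mono)
    also have "\<dots> = 2 powr (real a * tw j (real (C * n)))"
      by (simp add: powr_power mult.commute)
    also have "\<dots> \<le> 2 powr (real (a + 1) * tw j (real (C * n)))"
      using tw_ge_one[OF one, of j] by (intro powr_mono) (auto simp: algebra_simps)
    also have "\<dots> \<le> 2 powr (tw j (real (a + 1) * real (C * n)))"
      using tw_scale[OF one, of "a + 1" j] by (intro powr_mono) auto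
    finally show ?thesis using assms(2) by (simp only: tw_Suc of_nat_mult mult.assoc)
  qed
  then show ?thesis using C(1) unfolding tower_bounded_def
    by (intro exI[of _ "(a + 1) * C"]) auto
qed

text \<open>The power of the previous bound in the exponent of \<open>ramsey_bound\<close> stays
  within the same height, so each step of the recursion adds exactly one exponential to the
  height.\<close>

lemma tower_bounded_ramsey_bound:
  assumes "tower_bounded (Suc j) f" "j > 0"
  shows "tower_bounded (Suc j + k) (\<lambda>n. ramsey_bound q k (f n))"
proof (induction k)
  case 0
  then show ?case using tower_bounded_linear[OF assms(1), of q 0] by simp
next
  case (Suc k)
  have "tower_bounded (Suc (j + k)) (\<lambda>n. (q + 1) * (1 * ramsey_bound q k (f n) + 1) ^ (k + 2) + 0)"
    using Suc assms(2) by (intro tower_bounded_linear tower_bounded_power) auto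
  then show ?case using tower_bounded_exp by fastforce
qed

section \<open>Splitting a function of two indices\<close>

text \<open>\<open>ray up n i\<close> is the side of \<open>i\<close> from which a sequence growing (\<open>up\<close>) or shrinking
  (\<open>\<not> up\<close>) geometrically is summed, so that the entry next to \<open>i\<close> dominates.\<close>

definition ray :: "bool \<Rightarrow> nat \<Rightarrow> nat \<Rightarrow> nat set" where
  "ray up n i = (if up then {..<i} else {i..<n})"

lemma finite_ray [simp]: "finite (ray up n i)"
  by (simp add: ray_def)

text \<open>The factor 2 on the right is the loss near the diagonal. The distance 2 is forced by the
  case where the last step to \<open>i'\<close> must be seen in column \<open>j - 1\<close>: the
  unit box at \<open>(i' - 1, j - 1)\<close> is off the diagonal iff \<open>i' + 2 \<le> j\<close>.
  Which alternative holds may depend on the arguments.\<close>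

definition varies :: "nat \<Rightarrow> (nat \<Rightarrow> nat \<Rightarrow> real) \<Rightarrow> bool" where
  "varies n T \<longleftrightarrow>
    (\<forall>i i' j. i < i' \<and> i' + 2 \<le> j \<and> j < n \<longrightarrow>
      2 ^ (i' - i) * \<bar>T i j\<bar> \<le> 2 * \<bar>T i' j\<bar> \<or> 2 ^ (i' - i) * \<bar>T i' j\<bar> \<le> 2 * \<bar>T i j\<bar>) \<and>
    (\<forall>i j j'. i + 2 \<le> j \<and> j < j' \<and> j' < n \<longrightarrow>
      2 ^ (j' - j) * \<bar>T i j\<bar> \<le> 2 * \<bar>T i j'\<bar> \<or> 2 ^ (j' - j) * \<bar>T i j'\<bar> \<le> 2 * \<bar>T i j\<bar>)"

lemma doubling_up:
  fixes f :: "nat \<Rightarrow> real"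
  assumes "\<And>k. i \<le> k \<Longrightarrow> k < i' \<Longrightarrow> 2 * f k \<le> f (Suc k)" "i \<le> i'"
  shows "2 ^ (i' - i) * f i \<le> f i'"
  using assms(2,1)
proof (induction i' rule: dec_induct)
  case (step m)
  then have "2 * (2 ^ (m - i) * f i) \<le> 2 * f m" by simp
  also have "\<dots> \<le> f (Suc m)" using step by simp
  finally show ?case using step by (simp add: Suc_diff_le)
qed simp

lemma doubling_down:
  fixes f :: "nat \<Rightarrow> real"
  assumes "\<And>k. i \<le> k \<Longrightarrow> k < i' \<Longrightarrow> 2 * f (Suc k) \<le> f k" "i \<le> i'"
  shows "2 ^ (i' - i) * f i' \<le> f i"
  using assms(2,1)
proof (induction i' rule: dec_induct)
  case (step m)
  then have "2 * f (Suc m) \<le> f m" by simp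
  then have "2 ^ (m - i) * (2 * f (Suc m)) \<le> 2 ^ (m - i) * f m" by (rule mult_left_mono) simp
  also have "\<dots> \<le> f i" using step by simp
  finally show ?case using step by (simp add: Suc_diff_le mult_ac)
qed simp

text \<open>Each entry of \<open>b\<close> outweighs all entries beyond it on its ray, so partial
  sums in one variable double at each step, and sums of them over the other variable inherit this.
  The bounds \<open>I1\<close> and \<open>J2\<close> stop near the diagonal; this matters for a step
  in the first variable with both rays up and for a step in the second with both rays down.\<close>

lemma ray_sum_varies:
  fixes b :: "nat \<Rightarrow> nat \<Rightarrow> real"
  assumes nonneg: "\<And>a c. 0 \<le> b a c"
    and I1: "\<And>a c. upL \<Longrightarrow> a + 2 \<le> c \<Longrightarrow> (\<Sum>x<a. b x c) \<le> b a c"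
    and I2: "\<And>a c. \<not> upL \<Longrightarrow> (\<Sum>x\<in>{Suc a..<n}. b x c) \<le> b a c"
    and J1: "\<And>a c. upR \<Longrightarrow> Suc c < n \<Longrightarrow> (\<Sum>y<c. b a y) \<le> b a c"
    and J2: "\<And>a c. \<not> upR \<Longrightarrow> a + 2 \<le> c \<Longrightarrow> (\<Sum>y\<in>{Suc c..<n}. b a y) \<le> b a c"
  shows "varies n (\<lambda>i j. \<Sum>a\<in>ray upL n i. \<Sum>c\<in>ray upR n j. b a c)" (is "varies n ?T")
proof -
  define S1 where "S1 i c = (\<Sum>a\<in>ray upL n i. b a c)" for i c
  define S2 where "S2 a j = (\<Sum>c\<in>ray upR n j. b a c)" for a j
  have T1: "?T i j = (\<Sum>c\<in>ray upR n j. S1 i c)" for i j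
    unfolding S1_def by (rule sum.swap)
  have T2: "?T i j = (\<Sum>a\<in>ray upL n i. S2 a j)" for i j
    unfolding S2_def by simp
  have pos1: "0 \<le> S1 i c" for i c unfolding S1_def by (intro sum_nonneg nonneg)
  have pos2: "0 \<le> S2 a j" for a j unfolding S2_def by (intro sum_nonneg nonneg)
  have T_nonneg: "0 \<le> ?T i j" for i j by (intro sum_nonneg nonneg)
  then have posT: "\<bar>?T i j\<bar> = ?T i j" for i j by (rule abs_of_nonneg)
  have split: "{k..<n} = insert k {Suc k..<n}" if "k < n" for k using that by auto
  have upL: "2 ^ (i' - i) * S1 i c \<le> S1 i' c" if "upL" "i \<le> i'" "Suc i' \<le> c" for i i' c
    by (rule doubling_up) (use that I1[where c = c] in \<open>auto simp: S1_def ray_def\<close>)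
  have down1: "2 ^ (i' - i) * S1 i' c \<le> S1 i c" if "\<not> upL" "i \<le> i'" "i' \<le> n" for i i' c
    by (rule doubling_down) (use that I2[where c = c] in \<open>auto simp: S1_def ray_def split\<close>)
  have upR: "2 ^ (j' - j) * S2 a j \<le> S2 a j'" if "upR" "j \<le> j'" "j' < n" for j j' a
    by (rule doubling_up) (use that J1[where a = a] in \<open>auto simp: S2_def ray_def\<close>)
  have down2: "2 ^ (j' - j) * S2 a j' \<le> S2 a j" if "\<not> upR" "a + 2 \<le> j" "j \<le> j'" "j' \<le> n" for j j' a
    by (rule doubling_down) (use that J2[where a = a] in \<open>auto simp: S2_def ray_def split\<close>)
  have dir1: "2 ^ (i' - i) * ?T i j \<le> 2 * ?T i' j \<or> 2 ^ (i' - i) * ?T i' j \<le> 2 * ?T i j"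
    if ij: "i < i'" "i' + 2 \<le> j" "j < n" for i i' j
  proof (cases "upL")
    case False
    have "2 ^ (i' - i) * ?T i' j \<le> ?T i j"
      unfolding T1 sum_distrib_left using False ij by (intro sum_mono down1) auto
    then show ?thesis using T_nonneg[where i = i and j = j] by linarith
  next
    case u1: True
    show ?thesis
    proof (cases "upR")
      case False
      have "2 ^ (i' - i) * ?T i j \<le> ?T i' j"
        unfolding T1 sum_distrib_left using False u1 ij by (intro sum_mono upL) (auto simp: ray_def)
      then show ?thesis using T_nonneg[where i = i' and j = j] by linarith
    next
      case u2: True
      \<comment> \<open>Columns \<open>c \<le> i'\<close> are too close to the diagonal for
        doubling, but by \<open>J1\<close> column \<open>j - 1\<close> alone carries at least half
        of the sum.\<close>
      obtain c where c: "j = Suc c" using ij by (cases j) auto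
      have "?T i j \<le> (\<Sum>a\<in>ray upL n i. 2 * b a c)"
        using J1[where c = c] u2 c ij by (intro sum_mono) (auto simp: ray_def)
      also have "\<dots> = 2 * S1 i c" by (simp add: S1_def sum_distrib_left)
      finally have "2 ^ (i' - i) * ?T i j \<le> 2 ^ (i' - i) * (2 * S1 i c)" by (rule mult_left_mono) simp
      also have "\<dots> = 2 * (2 ^ (i' - i) * S1 i c)" by simp
      also have "\<dots> \<le> 2 * S1 i' c" using upL[of i i' c] u1 ij c by simp
      also have "S1 i' c \<le> ?T i' j" unfolding T1
        by (rule member_le_sum) (use pos1 u2 c in \<open>auto simp: ray_def\<close>)
      finally show ?thesis by simp
    qed
  qed
  have dir2: "2 ^ (j' - j) * ?T i j \<le> 2 * ?T i j' \<or> 2 ^ (j' - j) * ?T i j' \<le> 2 * ?T i j"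
    if ij: "i + 2 \<le> j" "j < j'" "j' < n" for i j j'
  proof (cases "upR")
    case True
    have "2 ^ (j' - j) * ?T i j \<le> ?T i j'"
      unfolding T2 sum_distrib_left using True ij by (intro sum_mono upR) auto
    then show ?thesis using T_nonneg[where i = i and j = j'] by linarith
  next
    case u2: False
    show ?thesis
    proof (cases "upL")
      case True
      have "2 ^ (j' - j) * ?T i j' \<le> ?T i j"
        unfolding T2 sum_distrib_left using True u2 ij by (intro sum_mono down2) (auto simp: ray_def)
      then show ?thesis using T_nonneg[where i = i and j = j] by linarith
    next
      case u1: False
      \<comment> \<open>Mirror image: by \<open>I2\<close> row \<open>i\<close> alone carries at
        least half of the sum.\<close>
      have "?T i j' \<le> (\<Sum>c\<in>ray upR n j'. 2 * b i c)"
        unfolding T1 using I2[where a = i] u1 ij by (intro sum_mono) (auto simp: ray_def S1_def split)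
      also have "\<dots> = 2 * S2 i j'" by (simp add: S2_def sum_distrib_left)
      finally have "2 ^ (j' - j) * ?T i j' \<le> 2 ^ (j' - j) * (2 * S2 i j')" by (rule mult_left_mono) simp
      also have "\<dots> = 2 * (2 ^ (j' - j) * S2 i j')" by simp
      also have "\<dots> \<le> 2 * S2 i j" using down2[of i j j'] u2 ij by simp
      also have "S2 i j \<le> ?T i j" unfolding T2
        by (rule member_le_sum) (use pos2 u1 ij in \<open>auto simp: ray_def\<close>)
      finally show ?thesis by simp
    qed
  qed
  show ?thesis unfolding varies_def posT using dir1 dir2 by blast
qed

section \<open>Second differences and the splitting into additive and strongly varying parts\<close>

definition second_diff :: "(nat \<Rightarrow> nat \<Rightarrow> real) \<Rightarrow> nat \<Rightarrow> nat \<Rightarrow> nat \<Rightarrow> nat \<Rightarrow> real" where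
  "second_diff g i i' j j' = g i' j' - g i' j - g i j' + g i j"

lemma second_diff_telescope:
  assumes "p \<le> q" "r \<le> s"
  shows "(\<Sum>a\<in>{p..<q}. \<Sum>c\<in>{r..<s}. second_diff g a (Suc a) c (Suc c)) = second_diff g p q r s"
proof -
  have "(\<Sum>c\<in>{r..<s}. second_diff g a (Suc a) c (Suc c))
      = (g (Suc a) s - g (Suc a) r) - (g a s - g a r)" for a
    using sum_Suc_diff'[OF assms(2), of "\<lambda>c. g (Suc a) c - g a c"]
    by (simp add: second_diff_def algebra_simps)
  then show ?thesis
    using sum_Suc_diff'[OF assms(1), of "\<lambda>a. g a s - g a r"] by (simp add: second_diff_def)
qed

lemma ray_sum_diff:
  fixes f :: "nat \<Rightarrow> real"
  assumes "i \<le> j" "j \<le> n"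
  shows "sum f (ray up n j) - sum f (ray up n i) = (if up then 1 else -1) * sum f {i..<j}"
proof -
  have "sum f {..<j} = sum f {..<i} + sum f {i..<j}" "sum f {i..<n} = sum f {i..<j} + sum f {j..<n}"
    using assms sum.atLeastLessThan_concat[of 0 i j f] sum.atLeastLessThan_concat[of i j n f]
    by (simp_all add: atLeast0LessThan)
  then show ?thesis by (simp add: ray_def)
qed

text \<open>Unit second differences over an interval telescope to the second difference of the whole
  interval, which the hypotheses bound by that of an adjacent unit interval; this is the dominance
  needed by \<open>ray_sum_varies\<close>. Removing \<open>T\<close> with the right sign leaves a
  \<open>G\<close> without second differences above the diagonal, and such a function is
  additive.\<close>

lemma pair_decomposition_nonneg:
  fixes g :: "nat \<Rightarrow> nat \<Rightarrow> real" and upL upR :: bool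
  assumes pos: "\<And>i i' j j'. i < i' \<Longrightarrow> i' < j \<Longrightarrow> j < j' \<Longrightarrow> j' < n \<Longrightarrow> 0 \<le> second_diff g i i' j j'"
    and I1: "\<And>i i' i'' j j'. upL \<Longrightarrow> i < i' \<Longrightarrow> i' < i'' \<Longrightarrow> i'' < j \<Longrightarrow> j < j' \<Longrightarrow> j' < n \<Longrightarrow>
      second_diff g i i' j j' \<le> second_diff g i' i'' j j'"
    and I2: "\<And>i i' i'' j j'. \<not> upL \<Longrightarrow> i < i' \<Longrightarrow> i' < i'' \<Longrightarrow> i'' < j \<Longrightarrow> j < j' \<Longrightarrow> j' < n \<Longrightarrow>
      second_diff g i' i'' j j' \<le> second_diff g i i' j j'"
    and J1: "\<And>i i' j j' j''. upR \<Longrightarrow> i < i' \<Longrightarrow> i' < j \<Longrightarrow> j < j' \<Longrightarrow> j' < j'' \<Longrightarrow> j'' < n \<Longrightarrow>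
      second_diff g i i' j j' \<le> second_diff g i i' j' j''"
    and J2: "\<And>i i' j j' j''. \<not> upR \<Longrightarrow> i < i' \<Longrightarrow> i' < j \<Longrightarrow> j < j' \<Longrightarrow> j' < j'' \<Longrightarrow> j'' < n \<Longrightarrow>
      second_diff g i i' j' j'' \<le> second_diff g i i' j j'"
  shows "\<exists>A B T. (\<forall>i j. i < j \<and> j < n \<longrightarrow> g i j = A i + B j + T i j) \<and> varies n T"
proof -
  \<comment> \<open>Hypotheses concern \<open>g i j\<close> with \<open>i < j\<close> only, so boxes meeting the diagonal must be cut off.\<close>
  define b where "b a c = (if a + 2 \<le> c \<and> Suc c < n then second_diff g a (Suc a) c (Suc c) else 0)" for a c
  define T where "T i j = (\<Sum>a\<in>ray upL n i. \<Sum>c\<in>ray upR n j. b a c)" for i j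
  \<comment> \<open>Advancing the index of a downward ray removes entries, so above the diagonal the
    second differences of \<open>T\<close> are \<open>s1 * s2\<close> times those of
    \<open>g\<close>.\<close>
  define s1 s2 :: real where "s1 = (if upL then 1 else -1)" and "s2 = (if upR then 1 else -1)"
  have s: "s1 * s2 * (s1 * s2) = 1" "\<bar>s1 * s2\<bar> = 1" by (auto simp: s1_def s2_def)
  have b0: "0 \<le> b a c" for a c using pos by (auto simp: b_def)
  have box: "(\<Sum>a\<in>{p..<q}. \<Sum>c\<in>{r..<s}. b a c) = second_diff g p q r s"
    if "p \<le> q" "r \<le> s" "q < r" "s < n" for p q r s
  proof -
    have "(\<Sum>a\<in>{p..<q}. \<Sum>c\<in>{r..<s}. b a c) =
      (\<Sum>a\<in>{p..<q}. \<Sum>c\<in>{r..<s}. second_diff g a (Suc a) c (Suc c))"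
      using that by (intro sum.cong refl) (auto simp: b_def)
    then show ?thesis using second_diff_telescope that by simp
  qed
  have box1: "(\<Sum>a\<in>{p..<q}. b a c) = second_diff g p q c (Suc c)"
    if "p \<le> q" "q < c" "Suc c < n" for p q c
    using box[of p q c "Suc c"] that by simp
  have box2: "(\<Sum>c\<in>{r..<s}. b a c) = second_diff g a (Suc a) r s"
    if "r \<le> s" "Suc a < r" "s < n" for r s a
    using box[of a "Suc a" r s] that by simp
  have "varies n T" unfolding T_def
  proof (rule ray_sum_varies)
    show "(\<Sum>x<a. b x c) \<le> b a c" if "upL" "a + 2 \<le> c" for a c
    proof (cases "Suc c < n \<and> a > 0")
      case True
      then show ?thesis
        using box1[of 0 a c] I1[of 0 a "Suc a" c "Suc c"] that by (simp add: atLeast0LessThan b_def)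
    next
      case False
      then have "(\<Sum>x<a. b x c) = 0" by (auto simp: b_def)
      then show ?thesis using b0 by simp
    qed
    show "(\<Sum>x\<in>{Suc a..<n}. b x c) \<le> b a c" if "\<not> upL" for a c
    proof (cases "Suc c < n \<and> a + 3 \<le> c")
      case True
      then have ac: "Suc a < c - 1" "c - 1 < c" "Suc (Suc a) \<le> c" by linarith+
      \<comment> \<open>Boxes with \<open>x \<ge> c - 1\<close> were cut off, so telescoping ends at
        \<open>c - 1\<close>, and \<open>I2\<close> compares the interval from \<open>a + 1\<close>
        to \<open>c - 1\<close> with the unit interval before it.\<close>
      have "(\<Sum>x\<in>{Suc a..<n}. b x c) = (\<Sum>x\<in>{Suc a..<c-1}. b x c)"
        using True by (intro sum.mono_neutral_right) (auto simp: b_def)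
      then show ?thesis
        using box1[of "Suc a" "c - 1" c] I2[of a "Suc a" "c - 1" c "Suc c"] that True ac
        by (simp add: b_def)
    next
      case False
      then have "(\<Sum>x\<in>{Suc a..<n}. b x c) = 0" by (intro sum.neutral) (auto simp: b_def)
      then show ?thesis using b0 by simp
    qed
    show "(\<Sum>y<c. b a y) \<le> b a c" if "upR" "Suc c < n" for a c
    proof (cases "a + 2 < c")
      case True
      have "(\<Sum>y<c. b a y) = (\<Sum>y\<in>{a+2..<c}. b a y)"
        by (intro sum.mono_neutral_right) (auto simp: b_def)
      then show ?thesis
        using box2[of "a + 2" c a] J1[of a "Suc a" "a + 2" c "Suc c"] that True
        by (simp add: b_def)
    next
      case False
      then have "(\<Sum>y<c. b a y) = 0" by (intro sum.neutral) (auto simp: b_def)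
      then show ?thesis using b0 by simp
    qed
    show "(\<Sum>y\<in>{Suc c..<n}. b a y) \<le> b a c" if "\<not> upR" "a + 2 \<le> c" for a c
    proof (cases "Suc (Suc c) < n")
      case True
      have "(\<Sum>y\<in>{Suc c..<n}. b a y) = (\<Sum>y\<in>{Suc c..<n-1}. b a y)"
        using True by (intro sum.mono_neutral_right) (auto simp: b_def)
      then show ?thesis
        using box2[of "Suc c" "n - 1" a] J2[of a "Suc a" c "Suc c" "n - 1"] that True
        by (simp add: b_def)
    next
      case False
      then have "(\<Sum>y\<in>{Suc c..<n}. b a y) = 0" by (intro sum.neutral) (auto simp: b_def)
      then show ?thesis using b0 by simp
    qed
  qed (rule b0)
  then have var: "varies n (\<lambda>i j. s1 * s2 * T i j)"
    using s(2) by (simp add: varies_def abs_mult)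
  define G where "G i j = g i j - s1 * s2 * T i j" for i j
  \<comment> \<open>The box from \<open>0\<close> to \<open>i\<close> and from \<open>i + 1\<close>
    to \<open>j\<close> stays above the diagonal. Vanishing of the second difference of
    \<open>G\<close> on it is exactly this equation, whose right side separates \<open>i\<close>
    from \<open>j\<close>.\<close>
  have G: "G i j = (G i (Suc i) - G 0 (Suc i)) + G 0 j" if ij: "i < j" "j < n" for i j
  proof -
    have d1: "T i l - T 0 l = s1 * (\<Sum>a\<in>{0..<i}. \<Sum>c\<in>ray upR n l. b a c)" for l
      unfolding T_def s1_def using ij by (intro ray_sum_diff) auto
    have d2: "(\<Sum>c\<in>ray upR n j. b a c) - (\<Sum>c\<in>ray upR n (Suc i). b a c) = s2 * (\<Sum>c\<in>{Suc i..<j}. b a c)" for a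
      unfolding s2_def using ij by (intro ray_sum_diff) auto
    have "second_diff T 0 i (Suc i) j = (T i j - T 0 j) - (T i (Suc i) - T 0 (Suc i))"
      by (simp add: second_diff_def)
    also have "\<dots> = s1 * s2 * (\<Sum>a\<in>{0..<i}. \<Sum>c\<in>{Suc i..<j}. b a c)"
      unfolding d1 right_diff_distrib[symmetric] sum_subtractf[symmetric] d2
      by (simp add: sum_distrib_left mult.assoc)
    also have "(\<Sum>a\<in>{0..<i}. \<Sum>c\<in>{Suc i..<j}. b a c) = second_diff g 0 i (Suc i) j"
      using ij by (intro box) auto
    finally have "s1 * s2 * second_diff T 0 i (Suc i) j = second_diff g 0 i (Suc i) j"
      using s(1) by (simp flip: mult.assoc)
    then show ?thesis by (simp add: G_def second_diff_def algebra_simps)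
  qed
  have "g i j = (G i (Suc i) - G 0 (Suc i)) + G 0 j + s1 * s2 * T i j" if "i < j \<and> j < n" for i j
    using G[of i j] that unfolding G_def by linarith
  then show ?thesis using var
    by (intro exI[of _ "\<lambda>i. G i (Suc i) - G 0 (Suc i)"] exI[of _ "\<lambda>j. G 0 j"]
        exI[of _ "\<lambda>i j. s1 * s2 * T i j"] conjI allI impI)
qed

lemma pair_decomposition:
  fixes g :: "nat \<Rightarrow> nat \<Rightarrow> real"
  assumes H0: "(\<forall>i i' j j'. i < i' \<and> i' < j \<and> j < j' \<and> j' < n \<longrightarrow> 0 \<le> second_diff g i i' j j') \<or>
      (\<forall>i i' j j'. i < i' \<and> i' < j \<and> j < j' \<and> j' < n \<longrightarrow> second_diff g i i' j j' \<le> 0)"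
    and H1: "(\<forall>i i' i'' j j'. i < i' \<and> i' < i'' \<and> i'' < j \<and> j < j' \<and> j' < n \<longrightarrow>
        \<bar>second_diff g i i' j j'\<bar> \<le> \<bar>second_diff g i' i'' j j'\<bar>) \<or>
      (\<forall>i i' i'' j j'. i < i' \<and> i' < i'' \<and> i'' < j \<and> j < j' \<and> j' < n \<longrightarrow>
        \<bar>second_diff g i' i'' j j'\<bar> \<le> \<bar>second_diff g i i' j j'\<bar>)"
    and H2: "(\<forall>i i' j j' j''. i < i' \<and> i' < j \<and> j < j' \<and> j' < j'' \<and> j'' < n \<longrightarrow>
        \<bar>second_diff g i i' j j'\<bar> \<le> \<bar>second_diff g i i' j' j''\<bar>) \<or>
      (\<forall>i i' j j' j''. i < i' \<and> i' < j \<and> j < j' \<and> j' < j'' \<and> j'' < n \<longrightarrow>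
        \<bar>second_diff g i i' j' j''\<bar> \<le> \<bar>second_diff g i i' j j'\<bar>)"
  shows "\<exists>A B T. (\<forall>i j. i < j \<and> j < n \<longrightarrow> g i j = A i + B j + T i j) \<and> varies n T"
proof -
  have main: "\<exists>A B T. (\<forall>i j. i < j \<and> j < n \<longrightarrow> f i j = A i + B j + T i j) \<and> varies n T"
    if pos: "\<forall>i i' j j'. i < i' \<and> i' < j \<and> j < j' \<and> j' < n \<longrightarrow> 0 \<le> second_diff f i i' j j'"
      and abs: "\<And>i i' j j'. \<bar>second_diff f i i' j j'\<bar> = \<bar>second_diff g i i' j j'\<bar>" for f
  proof -
    have eq: "\<bar>second_diff g i i' j j'\<bar> = second_diff f i i' j j'"
      if "i < i'" "i' < j" "j < j'" "j' < n" for i i' j j'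
      using pos abs[of i i' j j'] that by (metis abs_of_nonneg)
    define upL where "upL \<longleftrightarrow> (\<forall>i i' i'' j j'. i < i' \<and> i' < i'' \<and> i'' < j \<and> j < j' \<and> j' < n \<longrightarrow>
        \<bar>second_diff g i i' j j'\<bar> \<le> \<bar>second_diff g i' i'' j j'\<bar>)"
    define upR where "upR \<longleftrightarrow> (\<forall>i i' j j' j''. i < i' \<and> i' < j \<and> j < j' \<and> j' < j'' \<and> j'' < n \<longrightarrow>
        \<bar>second_diff g i i' j j'\<bar> \<le> \<bar>second_diff g i i' j' j''\<bar>)"
    show ?thesis
    proof (rule pair_decomposition_nonneg[where upL = upL and upR = upR])
      fix i i' i'' j j'
      assume *: "i < i'" "i' < i''" "i'' < j" "j < j'" "j' < n"
      show "second_diff f i i' j j' \<le> second_diff f i' i'' j j'" if upL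
      proof -
        have "\<bar>second_diff g i i' j j'\<bar> \<le> \<bar>second_diff g i' i'' j j'\<bar>"
          using that * unfolding upL_def by blast
        then show ?thesis using * eq[of i i' j j'] eq[of i' i'' j j'] by simp
      qed
      show "second_diff f i' i'' j j' \<le> second_diff f i i' j j'" if "\<not> upL"
      proof -
        have "\<bar>second_diff g i' i'' j j'\<bar> \<le> \<bar>second_diff g i i' j j'\<bar>"
          using that * H1 unfolding upL_def by blast
        then show ?thesis using * eq[of i i' j j'] eq[of i' i'' j j'] by simp
      qed
    next
      fix i i' j j' j''
      assume *: "i < i'" "i' < j" "j < j'" "j' < j''" "j'' < n"
      show "second_diff f i i' j j' \<le> second_diff f i i' j' j''" if upR
      proof -
        have "\<bar>second_diff g i i' j j'\<bar> \<le> \<bar>second_diff g i i' j' j''\<bar>"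
          using that * unfolding upR_def by blast
        then show ?thesis using * eq[of i i' j j'] eq[of i i' j' j''] by simp
      qed
      show "second_diff f i i' j' j'' \<le> second_diff f i i' j j'" if "\<not> upR"
      proof -
        have "\<bar>second_diff g i i' j' j''\<bar> \<le> \<bar>second_diff g i i' j j'\<bar>"
          using that * H2 unfolding upR_def by blast
        then show ?thesis using * eq[of i i' j j'] eq[of i i' j' j''] by simp
      qed
    qed (use pos in auto)
  qed
  show ?thesis
  proof (cases "\<forall>i i' j j'. i < i' \<and> i' < j \<and> j < j' \<and> j' < n \<longrightarrow> 0 \<le> second_diff g i i' j j'")
    case True
    then show ?thesis by (intro main) auto
  next
    case False
    have neg: "second_diff (\<lambda>i j. - g i j) i i' j j' = - second_diff g i i' j j'" for i i' j j'
      by (simp add: second_diff_def)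
    have "\<exists>A B T. (\<forall>i j. i < j \<and> j < n \<longrightarrow> - g i j = A i + B j + T i j) \<and> varies n T"
      using False H0 by (intro main) (auto simp: neg)
    then obtain A B T where *: "\<forall>i j. i < j \<and> j < n \<longrightarrow> - g i j = A i + B j + T i j" and "varies n T"
      by blast
    then have "varies n (\<lambda>i j. - T i j)" by (simp add: varies_def)
    moreover have "\<forall>i j. i < j \<and> j < n \<longrightarrow> g i j = - A i + - B j + - T i j" using * by force
    ultimately show ?thesis
      by (intro exI[of _ "\<lambda>i. - A i"] exI[of _ "\<lambda>j. - B j"] exI[of _ "\<lambda>i j. - T i j"]) simp
  qed
qed

text \<open>The pivot \<open>a\<close> is the value at the end where the increments are small:
  \<open>h 0\<close> if they grow, \<open>h (n - 1)\<close> if they shrink. By monotonicity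
  distances to the pivot add up, and the next increment away from it is at least the distance
  already covered.\<close>

lemma single_decomposition:
  fixes h :: "nat \<Rightarrow> real"
  assumes H0: "(\<forall>i j. i < j \<and> j < n \<longrightarrow> h i \<le> h j) \<or> (\<forall>i j. i < j \<and> j < n \<longrightarrow> h j \<le> h i)"
    and H1: "(\<forall>i j k. i < j \<and> j < k \<and> k < n \<longrightarrow> \<bar>h j - h i\<bar> \<le> \<bar>h k - h j\<bar>) \<or>
      (\<forall>i j k. i < j \<and> j < k \<and> k < n \<longrightarrow> \<bar>h k - h j\<bar> \<le> \<bar>h j - h i\<bar>)"
  shows "\<exists>a. \<forall>i j. i < j \<and> j < n \<longrightarrow>
      2 ^ (j - i) * \<bar>h i - a\<bar> \<le> \<bar>h j - a\<bar> \<or> 2 ^ (j - i) * \<bar>h j - a\<bar> \<le> \<bar>h i - a\<bar>"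
  using H1
proof
  assume H1: "\<forall>i j k. i < j \<and> j < k \<and> k < n \<longrightarrow> \<bar>h j - h i\<bar> \<le> \<bar>h k - h j\<bar>"
  have step: "2 * \<bar>h k - h 0\<bar> \<le> \<bar>h (Suc k) - h 0\<bar>" if "Suc k < n" for k
  proof (cases "k = 0")
    case False
    then have "\<bar>h k - h 0\<bar> \<le> \<bar>h (Suc k) - h k\<bar>" using H1 that by auto
    moreover have "\<bar>h (Suc k) - h 0\<bar> = \<bar>h k - h 0\<bar> + \<bar>h (Suc k) - h k\<bar>"
      using H0 False that by (smt (verit) Suc_lessD lessI neq0_conv)
    ultimately show ?thesis by simp
  qed simp
  have "2 ^ (j - i) * \<bar>h i - h 0\<bar> \<le> \<bar>h j - h 0\<bar>" if "i < j" "j < n" for i j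
    by (rule doubling_up[where f = "\<lambda>i. \<bar>h i - h 0\<bar>"]) (use step that in auto)
  then show ?thesis by blast
next
  assume H1: "\<forall>i j k. i < j \<and> j < k \<and> k < n \<longrightarrow> \<bar>h k - h j\<bar> \<le> \<bar>h j - h i\<bar>"
  define e where "e = n - 1"
  have step: "2 * \<bar>h (Suc k) - h e\<bar> \<le> \<bar>h k - h e\<bar>" if "Suc k < n" for k
  proof (cases "Suc k = e")
    case False
    then have lt: "Suc k < e" "e < n" using that by (auto simp: e_def)
    then have "\<bar>h e - h (Suc k)\<bar> \<le> \<bar>h (Suc k) - h k\<bar>" using H1 by auto
    moreover have "\<bar>h k - h e\<bar> = \<bar>h (Suc k) - h k\<bar> + \<bar>h e - h (Suc k)\<bar>"
      using H0 lt by (smt (verit) Suc_lessD lessI less_trans)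
    ultimately show ?thesis by (simp add: abs_minus_commute)
  qed simp
  have "2 ^ (j - i) * \<bar>h j - h e\<bar> \<le> \<bar>h i - h e\<bar>" if "i < j" "j < n" for i j
    by (rule doubling_down[where f = "\<lambda>i. \<bar>h i - h e\<bar>"]) (use step that in auto)
  then show ?thesis by blast
qed

section \<open>Homogeneous subsequences for two-variable and one-variable terms\<close>

lemma pair_homogeneous:
  fixes g :: "'i \<Rightarrow> nat \<Rightarrow> nat \<Rightarrow> real"
  assumes "finite I" "ramsey_bound (2 ^ (card I * 3 * 6)) 4 (n + 5) \<le> N"
  shows "\<exists>x. strict_mono_on {..<n} x \<and> x ` {..<n} \<subseteq> {..<N} \<and>
    (\<forall>k\<in>I. \<exists>A B T. (\<forall>i j. i < j \<and> j < n \<longrightarrow> g k (x i) (x j) = A i + B j + T i j) \<and> varies n T)"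
proof -
  \<comment> \<open>\<open>w\<close> selects the sign, the comparison of adjacent intervals in the
    first variable, or the one in the second. In the colour count, 3 stands for the values of
    \<open>w\<close> and 6 for the prefix lengths \<open>0\<close> to \<open>5\<close>.\<close>
  define P :: "'i \<times> nat \<Rightarrow> nat list \<Rightarrow> bool" where
    "P = (\<lambda>(k, w) ys. let D = \<lambda>a b c d. second_diff (g k) (ys ! a) (ys ! b) (ys ! c) (ys ! d) in
       if w = 0 then 0 \<le> D 0 1 2 3
       else if w = 1 then \<bar>D 0 1 3 4\<bar> \<le> \<bar>D 1 2 3 4\<bar>
       else \<bar>D 0 1 2 3\<bar> \<le> \<bar>D 0 1 3 4\<bar>)"
  have N: "ramsey_bound (2 ^ (card (I \<times> {..<3::nat}) * (4 + 2))) 4 (n + 4 + 1) \<le> N"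
  proof -
    have eq: "card (I \<times> {..<3::nat}) * (4 + 2) = card I * 3 * 6" "n + 4 + 1 = n + 5"
      by (simp_all add: card_cartesian_product)
    show ?thesis unfolding eq by (rule assms(2))
  qed
  obtain x where x: "strict_mono_on {..<n} x" "x ` {..<n} \<subseteq> {..<N}"
    and x_hom: "\<forall>i\<in>I \<times> {..<3}. \<forall>u\<le>4+1. (\<forall>ys\<in>incs {..<n} u. P i (map x ys)) \<or>
      (\<forall>ys\<in>incs {..<n} u. \<not> P i (map x ys))"
    using ramsey_family[OF _ refl N, of P] assms(1) by auto
  have hom: "(\<forall>ys\<in>incs {..<n} u. P (k, w) (map x ys)) \<or> (\<forall>ys\<in>incs {..<n} u. \<not> P (k, w) (map x ys))"
    if "k \<in> I" "w < 3" "u \<le> 5" for k w u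
    using bspec[OF x_hom, of "(k, w)"] that by simp
  have "\<exists>A B T. (\<forall>i j. i < j \<and> j < n \<longrightarrow> g k (x i) (x j) = A i + B j + T i j) \<and> varies n T"
    if k: "k \<in> I" for k
  proof (rule pair_decomposition)
    let ?D = "second_diff (\<lambda>i j. g k (x i) (x j))"
    have four: "[i, i', j, j'] \<in> incs {..<n} 4" if "i < i' \<and> i' < j \<and> j < j' \<and> j' < n" for i i' j j'
      using that by (auto simp: incs_def)
    have five: "[i, i', i'', j, j'] \<in> incs {..<n} 5"
      if "i < i' \<and> i' < i'' \<and> i'' < j \<and> j < j' \<and> j' < n" for i i' i'' j j'
      using that by (auto simp: incs_def)
    have P0: "P (k, 0) (map x [i, i', j, j']) \<longleftrightarrow> 0 \<le> ?D i i' j j'" for i i' j j'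
      by (simp add: P_def second_diff_def numeral_nat)
    have P1: "P (k, 1) (map x [i, i', i'', j, j']) \<longleftrightarrow> \<bar>?D i i' j j'\<bar> \<le> \<bar>?D i' i'' j j'\<bar>" for i i' i'' j j'
      by (simp add: P_def second_diff_def numeral_nat)
    have P2: "P (k, 2) (map x [i, i', j, j', j'']) \<longleftrightarrow> \<bar>?D i i' j j'\<bar> \<le> \<bar>?D i i' j' j''\<bar>" for i i' j j' j''
      by (simp add: P_def second_diff_def numeral_nat)
    show "(\<forall>i i' j j'. i < i' \<and> i' < j \<and> j < j' \<and> j' < n \<longrightarrow> 0 \<le> ?D i i' j j') \<or>
      (\<forall>i i' j j'. i < i' \<and> i' < j \<and> j < j' \<and> j' < n \<longrightarrow> ?D i i' j j' \<le> 0)"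
      using hom[OF k, of 0 4] four P0 by (smt (verit) zero_less_numeral numeral_le_iff semiring_norm)
    show "(\<forall>i i' i'' j j'. i < i' \<and> i' < i'' \<and> i'' < j \<and> j < j' \<and> j' < n \<longrightarrow>
        \<bar>?D i i' j j'\<bar> \<le> \<bar>?D i' i'' j j'\<bar>) \<or>
      (\<forall>i i' i'' j j'. i < i' \<and> i' < i'' \<and> i'' < j \<and> j < j' \<and> j' < n \<longrightarrow>
        \<bar>?D i' i'' j j'\<bar> \<le> \<bar>?D i i' j j'\<bar>)"
      using hom[OF k, of 1 5] five P1 by (metis linear order_refl one_less_numeral_iff semiring_norm(77))
    show "(\<forall>i i' j j' j''. i < i' \<and> i' < j \<and> j < j' \<and> j' < j'' \<and> j'' < n \<longrightarrow>
        \<bar>?D i i' j j'\<bar> \<le> \<bar>?D i i' j' j''\<bar>) \<or>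
      (\<forall>i i' j j' j''. i < i' \<and> i' < j \<and> j < j' \<and> j' < j'' \<and> j'' < n \<longrightarrow>
        \<bar>?D i i' j' j''\<bar> \<le> \<bar>?D i i' j j'\<bar>)"
      using hom[OF k, of 2 5] five P2 by (metis linear order_refl lessI numeral_2_eq_2 numeral_3_eq_3)
  qed
  then show ?thesis using x by blast
qed

lemma single_homogeneous:
  fixes h :: "'i \<Rightarrow> nat \<Rightarrow> real"
  assumes "finite I" "ramsey_bound (2 ^ (card I * 2 * 4)) 2 (n + 3) \<le> N"
  shows "\<exists>x. strict_mono_on {..<n} x \<and> x ` {..<n} \<subseteq> {..<N} \<and>
    (\<forall>k\<in>I. \<exists>a. \<forall>i j. i < j \<and> j < n \<longrightarrow>
      2 ^ (j - i) * \<bar>h k (x i) - a\<bar> \<le> \<bar>h k (x j) - a\<bar> \<or>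
      2 ^ (j - i) * \<bar>h k (x j) - a\<bar> \<le> \<bar>h k (x i) - a\<bar>)"
proof -
  define P :: "'i \<times> nat \<Rightarrow> nat list \<Rightarrow> bool" where
    "P = (\<lambda>(k, w) ys. if w = 0 then h k (ys ! 0) \<le> h k (ys ! 1)
       else \<bar>h k (ys ! 1) - h k (ys ! 0)\<bar> \<le> \<bar>h k (ys ! 2) - h k (ys ! 1)\<bar>)"
  have N: "ramsey_bound (2 ^ (card (I \<times> {..<2::nat}) * (2 + 2))) 2 (n + 2 + 1) \<le> N"
  proof -
    have eq: "card (I \<times> {..<2::nat}) * (2 + 2) = card I * 2 * 4" "n + 2 + 1 = n + 3"
      by (simp_all add: card_cartesian_product)
    show ?thesis unfolding eq by (rule assms(2))
  qed
  obtain x where x: "strict_mono_on {..<n} x" "x ` {..<n} \<subseteq> {..<N}"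
    and x_hom: "\<forall>i\<in>I \<times> {..<2}. \<forall>u\<le>2+1. (\<forall>ys\<in>incs {..<n} u. P i (map x ys)) \<or>
      (\<forall>ys\<in>incs {..<n} u. \<not> P i (map x ys))"
    using ramsey_family[OF _ refl N, of P] assms(1) by auto
  have hom: "(\<forall>ys\<in>incs {..<n} u. P (k, w) (map x ys)) \<or> (\<forall>ys\<in>incs {..<n} u. \<not> P (k, w) (map x ys))"
    if "k \<in> I" "w < 2" "u \<le> 3" for k w u
    using bspec[OF x_hom, of "(k, w)"] that by simp
  have "\<exists>a. \<forall>i j. i < j \<and> j < n \<longrightarrow>
      2 ^ (j - i) * \<bar>h k (x i) - a\<bar> \<le> \<bar>h k (x j) - a\<bar> \<or>
      2 ^ (j - i) * \<bar>h k (x j) - a\<bar> \<le> \<bar>h k (x i) - a\<bar>" if k: "k \<in> I" for k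
  proof (rule single_decomposition)
    have two: "[i, j] \<in> incs {..<n} 2" if "i < j \<and> j < n" for i j
      using that by (auto simp: incs_def)
    have three: "[i, j, l] \<in> incs {..<n} 3" if "i < j \<and> j < l \<and> l < n" for i j l
      using that by (auto simp: incs_def)
    have P0: "P (k, 0) (map x [i, j]) \<longleftrightarrow> h k (x i) \<le> h k (x j)" for i j
      by (simp add: P_def)
    have P1: "P (k, 1) (map x [i, j, l]) \<longleftrightarrow> \<bar>h k (x j) - h k (x i)\<bar> \<le> \<bar>h k (x l) - h k (x j)\<bar>" for i j l
      by (simp add: P_def numeral_nat)
    show "(\<forall>i j. i < j \<and> j < n \<longrightarrow> h k (x i) \<le> h k (x j)) \<or> (\<forall>i j. i < j \<and> j < n \<longrightarrow> h k (x j) \<le> h k (x i))"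
      using hom[OF k, of 0 2] two P0 by (smt (verit) zero_less_numeral numeral_le_iff semiring_norm)
    show "(\<forall>i j l. i < j \<and> j < l \<and> l < n \<longrightarrow> \<bar>h k (x j) - h k (x i)\<bar> \<le> \<bar>h k (x l) - h k (x j)\<bar>) \<or>
      (\<forall>i j l. i < j \<and> j < l \<and> l < n \<longrightarrow> \<bar>h k (x l) - h k (x j)\<bar> \<le> \<bar>h k (x j) - h k (x i)\<bar>)"
      using hom[OF k, of 1 3] three P1 by (metis linear order_refl one_less_numeral_iff semiring_norm(76))
  qed
  then show ?thesis using x by blast
qed

section \<open>Domination among terms with distinct supports\<close>

lemma incr_tuple_less:
  assumes "incr_tuple r S t" "k < l" "l < r"
  shows "t k < t l"
  using assms(2,3)
proof (induction rule: less_Suc_induct[of k l, consumes 1, case_names Suc trans])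
  case (Suc i)
  then show ?case using assms(1) by (simp add: incr_tuple_def)
qed (auto intro: less_trans)

text \<open>The rank of \<open>k\<close> in \<open>U\<close> locates, in a list holding only the
  entries at positions in \<open>U\<close>, the entry that belongs to position
  \<open>k\<close>.\<close>

lemma sorted_list_of_set_nth_card:
  fixes U :: "nat set"
  assumes "finite U" "k \<in> U"
  shows "sorted_list_of_set U ! card {u \<in> U. u < k} = k"
proof -
  let ?l = "sorted_list_of_set U"
  obtain i where i: "i < length ?l" "?l ! i = k"
    using assms by (metis in_set_conv_nth set_sorted_list_of_set)
  have less: "?l ! a < ?l ! b \<longleftrightarrow> a < b" if "a < length ?l" "b < length ?l" for a b
    using that strict_sorted_list_of_set[of U] sorted_wrt_nth_less[of "(<)" ?l]
    by (metis less_asym linorder_neqE_nat)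
  have "{u \<in> U. u < k} = (!) ?l ` {..<i}"
  proof (intro set_eqI iffI)
    fix u assume u: "u \<in> {u \<in> U. u < k}"
    then obtain a where "a < length ?l" "?l ! a = u"
      using assms by (metis (mono_tags, lifting) in_set_conv_nth mem_Collect_eq set_sorted_list_of_set)
    then show "u \<in> (!) ?l ` {..<i}" using u i less by auto
  next
    fix u assume "u \<in> (!) ?l ` {..<i}"
    then obtain a where "a < i" "u = ?l ! a" by auto
    then show "u \<in> {u \<in> U. u < k}"
      using i less[of a i] assms nth_mem[of a ?l] by auto
  qed
  moreover have "inj_on ((!) ?l) {..<i}" using i by (intro inj_on_nth) auto
  ultimately have "card {u \<in> U. u < k} = i" by (simp add: card_image)
  then show ?thesis using i by simp
qed

text \<open>The other \<open>card I - 1\<close> terms together reach at most the fraction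
  \<open>(card I - 1) / card I\<close> of \<open>\<bar>f a\<bar>\<close>, so they cannot cancel
  it.\<close>

lemma sgn_sum_dominant:
  fixes f :: "'i \<Rightarrow> real"
  assumes "finite I" "a \<in> I" "f a \<noteq> 0"
    and "\<And>b. b \<in> I \<Longrightarrow> b \<noteq> a \<Longrightarrow> real (card I) * \<bar>f b\<bar> \<le> \<bar>f a\<bar>"
  shows "sgn (sum f I) = sgn (f a)"
proof -
  have "real (card I) * \<bar>sum f (I - {a})\<bar> \<le> (\<Sum>b\<in>I - {a}. real (card I) * \<bar>f b\<bar>)"
    using sum_abs[of f "I - {a}"] by (simp add: mult_left_mono flip: sum_distrib_left)
  also have "\<dots> \<le> (\<Sum>b\<in>I - {a}. \<bar>f a\<bar>)" using assms(4) by (intro sum_mono) auto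
  also have "\<dots> = real (card I - 1) * \<bar>f a\<bar>" using assms(1,2) by simp
  finally have le: "real (card I) * \<bar>sum f (I - {a})\<bar> \<le> real (card I - 1) * \<bar>f a\<bar>" .
  have "card I > 0" using assms(1,2) card_gt_0_iff by blast
  then have "real (card I - 1) * \<bar>f a\<bar> < real (card I) * \<bar>f a\<bar>"
    using assms(3) by (intro mult_strict_right_mono) auto
  with le have "real (card I) * \<bar>sum f (I - {a})\<bar> < real (card I) * \<bar>f a\<bar>" by linarith
  then have "\<bar>sum f (I - {a})\<bar> < \<bar>f a\<bar>" by (rule mult_left_less_imp_less) simp
  moreover have "sum f I = f a + sum f (I - {a})" using assms(1,2) by (rule sum.remove)
  ultimately have "(0 < f a \<and> 0 < sum f I) \<or> (f a < 0 \<and> sum f I < 0)" using assms(3) by linarith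
  then show ?thesis by auto
qed

lemma dominance_homogeneous:
  fixes m :: "'i \<Rightarrow> (nat \<Rightarrow> nat) \<Rightarrow> real" and supp :: "'i \<Rightarrow> nat set"
  assumes fin: "finite I"
    and supp: "\<And>a. a \<in> I \<Longrightarrow> supp a \<subseteq> {..<r}" "\<And>a. a \<in> I \<Longrightarrow> card (supp a) \<le> 2" "inj_on supp I"
    and local: "\<And>a t t'. a \<in> I \<Longrightarrow> (\<And>k. k \<in> supp a \<Longrightarrow> t k = t' k) \<Longrightarrow> m a t = m a t'"
    and strong: "\<And>a k t v. a \<in> I \<Longrightarrow> k \<in> supp a \<Longrightarrow> t k < v \<Longrightarrow>
      incr_tuple r {..<N} t \<Longrightarrow> incr_tuple r {..<N} (t(k := v)) \<Longrightarrow>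
      m a t = 0 \<or> m a (t(k := v)) = 0 \<or>
      real (card I) ^ 2 * \<bar>m a t\<bar> < \<bar>m a (t(k := v))\<bar> \<or> real (card I) ^ 2 * \<bar>m a (t(k := v))\<bar> < \<bar>m a t\<bar>"
    and N: "ramsey_bound (2 ^ (card I * card I * 15)) 3 (n + 2 * r + 5) \<le> N"
  shows "\<exists>x. strict_mono_on {..<n} x \<and> x ` {..<n} \<subseteq> {..<N} \<and>
    (\<forall>t t'. incr_tuple r {..<n} t \<and> incr_tuple r {..<n} t' \<longrightarrow>
      sgn (\<Sum>a\<in>I. m a (x \<circ> t)) = sgn (\<Sum>a\<in>I. m a (x \<circ> t')))"
proof -
  \<comment> \<open>The additional \<open>2 * r + 1\<close> indices make room for test tuples with
    entries up to \<open>2 * r - 1\<close>, however small \<open>n\<close> is.\<close>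
  define n' where "n' = n + 2 * r + 1"
  define M where "M = real (card I)"
  \<comment> \<open>Rebuilds a tuple from the list of its entries at positions in \<open>U\<close>.
    Other positions receive arbitrary values, which \<open>local\<close> makes harmless.\<close>
  define pos where "pos U ys k = (ys :: nat list) ! card {u \<in> U. u < (k :: nat)}" for U ys k
  define P :: "('i \<times> 'i) \<times> nat \<Rightarrow> nat list \<Rightarrow> bool" where
    "P = (\<lambda>((a, b), w) ys. let \<tau> = pos (supp a \<union> supp b) ys in
       if w = 0 then M * \<bar>m a \<tau>\<bar> < \<bar>m b \<tau>\<bar> else if w = 1 then 0 < m a \<tau> else m a \<tau> < 0)"
  have N': "ramsey_bound (2 ^ (card ((I \<times> I) \<times> {..<3::nat}) * (3 + 2))) 3 (n' + 3 + 1) \<le> N"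
  proof -
    have eq: "card ((I \<times> I) \<times> {..<3::nat}) * (3 + 2) = card I * card I * 15" "n' + 3 + 1 = n + 2 * r + 5"
      by (simp_all add: card_cartesian_product n'_def)
    show ?thesis unfolding eq by (rule N)
  qed
  obtain x where x: "strict_mono_on {..<n'} x" "x ` {..<n'} \<subseteq> {..<N}"
    and x_hom: "\<forall>i\<in>(I \<times> I) \<times> {..<3}. \<forall>u\<le>3+1. (\<forall>ys\<in>incs {..<n'} u. P i (map x ys)) \<or>
      (\<forall>ys\<in>incs {..<n'} u. \<not> P i (map x ys))"
    using ramsey_family[OF _ refl N', of P] fin by auto
  have finS: "finite (supp a)" if "a \<in> I" for a using supp(1)[OF that] finite_subset by blast
  have xt: "incr_tuple r {..<N} (x \<circ> t)" if "incr_tuple r {..<n'} t" for t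
    using that x by (fastforce simp: incr_tuple_def strict_mono_on_def)
  have hom: "P ((a, b), w) (map x (map t (sorted_list_of_set (supp a \<union> supp b)))) =
      P ((a, b), w) (map x (map t' (sorted_list_of_set (supp a \<union> supp b))))"
    if ab: "a \<in> I" "b \<in> I" and w: "w < 3" and t: "incr_tuple r {..<n'} t" "incr_tuple r {..<n'} t'" for a b w t t'
  proof -
    let ?U = "supp a \<union> supp b"
    have U: "?U \<subseteq> {..<r}" "finite ?U" using supp(1) finS ab by auto
    have c: "card ?U \<le> 4" using card_Un_le[of "supp a" "supp b"] supp(2)[OF ab(1)] supp(2)[OF ab(2)] by linarith
    have "map s (sorted_list_of_set ?U) \<in> incs {..<n'} (card ?U)" if s: "incr_tuple r {..<n'} s" for s
    proof -
      have "sorted_wrt (\<lambda>x y. s x < s y) (sorted_list_of_set ?U)"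
        by (rule sorted_wrt_mono_rel[OF _ strict_sorted_list_of_set])
          (use U incr_tuple_less[OF s] in auto)
      then show ?thesis using U s by (auto simp: incs_def sorted_wrt_map incr_tuple_def)
    qed
    then show ?thesis using bspec[OF x_hom, of "((a, b), w)"] ab w c t by fastforce
  qed
  have read: "m c (pos (supp a \<union> supp b) (map x (map t (sorted_list_of_set (supp a \<union> supp b))))) = m c (x \<circ> t)"
    if "a \<in> I" "b \<in> I" "c = a \<or> c = b" for a b c t
  proof (rule local)
    let ?U = "supp a \<union> supp b"
    fix k assume "k \<in> supp c"
    then have k: "k \<in> ?U" using that by auto
    have U: "finite ?U" using finS that by auto
    have "card {u \<in> ?U. u < k} < card ?U" using k U by (intro psubset_card_mono) auto
    then show "pos ?U (map x (map t (sorted_list_of_set ?U))) k = (x \<circ> t) k"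
      using sorted_list_of_set_nth_card[OF U k] by (simp add: pos_def del: Un_iff)
  qed (use that in auto)
  have dom_hom: "M * \<bar>m a (x \<circ> t)\<bar> < \<bar>m b (x \<circ> t)\<bar> \<longleftrightarrow> M * \<bar>m a (x \<circ> t')\<bar> < \<bar>m b (x \<circ> t')\<bar>"
    if "a \<in> I" "b \<in> I" "incr_tuple r {..<n'} t" "incr_tuple r {..<n'} t'" for a b t t'
    using hom[of a b 0 t t'] read[of a b a] read[of a b b] that by (simp add: P_def Let_def)
  have sgn_hom: "sgn (m a (x \<circ> t)) = sgn (m a (x \<circ> t'))"
    if "a \<in> I" "incr_tuple r {..<n'} t" "incr_tuple r {..<n'} t'" for a t t'
    using hom[of a a 1 t t'] hom[of a a 2 t t'] read[of a a a] that by (auto simp add: P_def Let_def sgn_if)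
  have not_comparable: "M * \<bar>m a (x \<circ> t)\<bar> < \<bar>m b (x \<circ> t)\<bar> \<or> M * \<bar>m b (x \<circ> t)\<bar> < \<bar>m a (x \<circ> t)\<bar>"
    if ab: "a \<in> I" "b \<in> I" and k: "k \<in> supp a" "k \<notin> supp b"
      and nz: "m a (x \<circ> t) \<noteq> 0" and t: "incr_tuple r {..<n'} t" for a b k t
  proof (rule ccontr)
    assume neg: "\<not> ?thesis"
    \<comment> \<open>Two tuples differing only in position \<open>k\<close>: the gaps of \<open>s\<close> leave room for \<open>2 * k + 1\<close>.\<close>
    define s where "s = (\<lambda>i::nat. 2 * i)"
    define s' where "s' = s(k := 2 * k + 1)"
    have kr: "k < r" using k supp(1)[OF ab(1)] by auto
    have s: "incr_tuple r {..<n'} s" "incr_tuple r {..<n'} s'"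
      using kr by (auto simp: incr_tuple_def s_def s'_def n'_def)
    have xs': "x \<circ> s' = (x \<circ> s)(k := x (2 * k + 1))" by (auto simp: s'_def)
    have lt: "(x \<circ> s) k < x (2 * k + 1)"
      using x(1) kr by (auto simp: strict_mono_on_def s_def n'_def)
    have "m b (x \<circ> s') = m b (x \<circ> s)"
      using k ab by (intro local) (auto simp: s'_def)
    moreover have cmp: "\<bar>m b (x \<circ> u)\<bar> \<le> M * \<bar>m a (x \<circ> u)\<bar>" "\<bar>m a (x \<circ> u)\<bar> \<le> M * \<bar>m b (x \<circ> u)\<bar>"
      if "incr_tuple r {..<n'} u" for u
      using neg dom_hom[OF ab that t] dom_hom[OF ab(2,1) that t] by auto
    ultimately have b: "\<bar>m b (x \<circ> s)\<bar> \<le> M * \<bar>m a (x \<circ> s')\<bar>" "\<bar>m a (x \<circ> s')\<bar> \<le> M * \<bar>m b (x \<circ> s)\<bar>"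
      using cmp[OF s(2)] by simp_all
    have "M \<ge> 0" by (simp add: M_def)
    \<comment> \<open>The two values of \<open>m a\<close> are compared through the unmoved
      \<open>m b\<close>, at the price of a factor \<open>M\<close> on either side.\<close>
    then have "\<bar>m a (x \<circ> s)\<bar> \<le> M ^ 2 * \<bar>m a (x \<circ> s')\<bar>" "\<bar>m a (x \<circ> s')\<bar> \<le> M ^ 2 * \<bar>m a (x \<circ> s)\<bar>"
      using b cmp[OF s(1)] mult_left_mono[OF b(1), of M] mult_left_mono[OF cmp(1)[OF s(1)], of M]
      by (auto simp: power2_eq_square mult.assoc)
    moreover have "m a (x \<circ> s) \<noteq> 0" "m a (x \<circ> s') \<noteq> 0"
      using sgn_hom[OF ab(1) t s(1)] sgn_hom[OF ab(1) t s(2)] nz by (auto simp: sgn_0_0 sgn_zero_iff)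
    ultimately show False
      using strong[OF ab(1) k(1) lt xt[OF s(1)]] xt[OF s(2)] unfolding xs' M_def[symmetric] by auto
  qed
  have trichotomy: "M * \<bar>m a (x \<circ> t)\<bar> < \<bar>m b (x \<circ> t)\<bar> \<or> M * \<bar>m b (x \<circ> t)\<bar> < \<bar>m a (x \<circ> t)\<bar>"
    if ab: "a \<in> I" "b \<in> I" "a \<noteq> b" and nz: "m a (x \<circ> t) \<noteq> 0" "m b (x \<circ> t) \<noteq> 0"
      and t: "incr_tuple r {..<n'} t" for a b t
  proof -
    have "supp a \<noteq> supp b" using supp(3) ab by (auto simp: inj_on_def)
    then obtain k where "k \<in> supp a \<and> k \<notin> supp b \<or> k \<in> supp b \<and> k \<notin> supp a" by auto
    then show ?thesis using not_comparable[of a b k t] not_comparable[of b a k t] that by blast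
  qed
  have const: "sgn (\<Sum>a\<in>I. m a (x \<circ> t)) = sgn (\<Sum>a\<in>I. m a (x \<circ> t'))"
    if t: "incr_tuple r {..<n'} t" "incr_tuple r {..<n'} t'" for t t'
  proof (cases "\<forall>a\<in>I. m a (x \<circ> t) = 0")
    case True
    then have "\<forall>a\<in>I. m a (x \<circ> t') = 0" using sgn_hom[OF _ t] by (metis sgn_0 sgn_zero_iff)
    then show ?thesis using True by simp
  next
    case False
    then have ne: "I \<noteq> {}" by auto
    \<comment> \<open>A term of largest size at \<open>t\<close> cannot be dominated there, so by
      \<open>trichotomy\<close> it dominates every other nonzero term, and \<open>dom_hom\<close>
      carries this over to \<open>t'\<close>.\<close>
    define f where "f b = \<bar>m b (x \<circ> t)\<bar>" for b
    have "Max (f ` I) \<in> f ` I" using fin ne by (intro Max_in) auto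
    then obtain a where "a \<in> I" "f a = Max (f ` I)" by force
    then have a: "a \<in> I" "\<And>b. b \<in> I \<Longrightarrow> \<bar>m b (x \<circ> t)\<bar> \<le> \<bar>m a (x \<circ> t)\<bar>"
      using fin by (auto simp flip: f_def)
    have nz: "m a (x \<circ> t) \<noteq> 0" using False a(2) by fastforce
    then have nz': "m a (x \<circ> t') \<noteq> 0" using sgn_hom[OF a(1) t] by (auto simp: sgn_zero_iff)
    have "M \<ge> 1" using fin ne by (simp add: M_def card_gt_0_iff Suc_leI)
    have dom: "M * \<bar>m b (x \<circ> t)\<bar> \<le> \<bar>m a (x \<circ> t)\<bar> \<and> M * \<bar>m b (x \<circ> t')\<bar> \<le> \<bar>m a (x \<circ> t')\<bar>"
      if b: "b \<in> I" "b \<noteq> a" for b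
    proof (cases "m b (x \<circ> t) = 0")
      case True
      then show ?thesis using sgn_hom[OF b(1) t] by (auto simp: sgn_zero_iff)
    next
      case False
      have "\<bar>m a (x \<circ> t)\<bar> \<le> M * \<bar>m a (x \<circ> t)\<bar>" using \<open>M \<ge> 1\<close> by (simp add: mult_le_cancel_right1)
      then have "\<not> M * \<bar>m a (x \<circ> t)\<bar> < \<bar>m b (x \<circ> t)\<bar>" using a(2)[OF b(1)] by linarith
      then have "M * \<bar>m b (x \<circ> t)\<bar> < \<bar>m a (x \<circ> t)\<bar>" using trichotomy[of a b t] a(1) b nz False t by auto
      then show ?thesis using dom_hom[OF b(1) a(1) t] by auto
    qed
    show ?thesis
      using sgn_sum_dominant[OF fin a(1), of "\<lambda>a. m a (x \<circ> t)"] sgn_sum_dominant[OF fin a(1), of "\<lambda>a. m a (x \<circ> t')"]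
        nz nz' dom sgn_hom[OF a(1) t] by (simp add: M_def)
  qed
  have sub: "{..<n} \<subseteq> {..<n'}" by (auto simp: n'_def)
  have "incr_tuple r {..<n'} t" if "incr_tuple r {..<n} t" for t
    using that sub by (auto simp: incr_tuple_def)
  then show ?thesis
    using monotone_on_subset[OF x(1) sub] order_trans[OF image_mono[OF sub] x(2)] const
    by (intro exI[of _ x] conjI allI impI) auto
qed

section \<open>Sums of functions of two indices\<close>

definition index_pairs :: "nat \<Rightarrow> (nat \<times> nat) set" where
  "index_pairs r = {(k, l). k < l \<and> l < r}"

lemma finite_index_pairs [simp]: "finite (index_pairs r)"
  by (rule finite_subset[of _ "{..<r} \<times> {..<r}"]) (auto simp: index_pairs_def)

lemma sum_square_index_pairs:
  fixes w :: "nat \<Rightarrow> nat \<Rightarrow> real"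
  shows "(\<Sum>k<r. \<Sum>l<r. w k l) = (\<Sum>(k, l)\<in>index_pairs r. w k l + w l k) + (\<Sum>k<r. w k k)"
proof (induction r)
  case 0
  then show ?case by (simp add: index_pairs_def)
next
  case (Suc r)
  have eq: "index_pairs (Suc r) = index_pairs r \<union> (\<lambda>k. (k, r)) ` {..<r}"
    by (auto simp: index_pairs_def)
  have "(\<Sum>(k, l)\<in>index_pairs (Suc r). w k l + w l k) =
      (\<Sum>(k, l)\<in>index_pairs r. w k l + w l k) + (\<Sum>(k, l)\<in>(\<lambda>k. (k, r)) ` {..<r}. w k l + w l k)"
    unfolding eq by (intro sum.union_disjoint finite_index_pairs finite_imageI finite_lessThan) (auto simp: index_pairs_def)
  also have "(\<Sum>(k, l)\<in>(\<lambda>k. (k, r)) ` {..<r}. w k l + w l k) = (\<Sum>k<r. w k r + w r k)"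
    by (subst sum.reindex) (auto simp: inj_on_def)
  finally show ?case using Suc by (simp add: sum.distrib)
qed

lemma strict_mono_on_gap:
  fixes x :: "nat \<Rightarrow> nat"
  assumes "strict_mono_on {..<n} x" "i \<le> j" "j < n"
  shows "x i + (j - i) \<le> x j"
  using assms(2,3)
proof (induction j rule: dec_induct)
  case (step j)
  then have "x j < x (Suc j)" using assms(1) by (auto simp: strict_mono_on_def)
  then show ?case using step by auto
qed simp

lemma doubling_gap:
  fixes a b :: real
  assumes "2 ^ d * \<bar>a\<bar> \<le> 2 * \<bar>b\<bar>" "a \<noteq> 0" "L \<le> d" "2 * Q < 2 ^ L"
  shows "Q * \<bar>a\<bar> < \<bar>b\<bar>"
proof -
  have "2 * Q < 2 ^ d" using assms(3,4) by (meson less_le_trans one_le_numeral power_increasing)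
  then have "2 * Q * \<bar>a\<bar> < 2 ^ d * \<bar>a\<bar>" using assms(2) by simp
  then show ?thesis using assms(1) by linarith
qed

text \<open>Three nested subsequences \<open>x1\<close>, \<open>x2\<close>, \<open>x3\<close> serve
  the pair terms, the one-variable terms and the comparisons. The bound on \<open>2 ^ L\<close>
  turns a gap of \<open>L\<close> into the factor required by \<open>dominance_homogeneous\<close>,
  and \<open>2 \<le> L\<close> keeps arguments as far apart as \<open>varies\<close>
  demands.\<close>

lemma pair_sum_homogeneous:
  fixes g :: "nat \<Rightarrow> nat \<Rightarrow> nat \<Rightarrow> nat \<Rightarrow> real" and h :: "nat \<Rightarrow> nat \<Rightarrow> real" and c :: real and r :: nat
  defines "F \<equiv> \<lambda>t. (\<Sum>(k, l)\<in>index_pairs r. g k l (t k) (t l)) + (\<Sum>k<r. h k (t k)) + c"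
  assumes I: "I = insert (r, r) (index_pairs r \<union> (\<lambda>k. (k, k)) ` {..<r})"
    and L: "2 * real (card I) ^ 2 < 2 ^ L" "2 \<le> L"
    and n3: "n3 = ramsey_bound (2 ^ (card I * card I * 15)) 3 (n + 2 * r + 5)"
    and n1: "n1 = ramsey_bound (2 ^ (r * 2 * 4)) 2 (L * n3 + 3)"
    and N: "ramsey_bound (2 ^ (card (index_pairs r) * 3 * 6)) 4 (n1 + 5) \<le> N"
  shows "\<exists>x. strict_mono_on {..<n} x \<and> x ` {..<n} \<subseteq> {..<N} \<and>
    (\<forall>t t'. incr_tuple r {..<n} t \<and> incr_tuple r {..<n} t' \<longrightarrow> sgn (F (x \<circ> t)) = sgn (F (x \<circ> t')))"
proof -
  let ?K = "index_pairs r"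
  obtain x1 where x1: "strict_mono_on {..<n1} x1" "x1 ` {..<n1} \<subseteq> {..<N}"
    and ex: "\<forall>p\<in>?K. \<exists>A B T. (\<forall>i j. i < j \<and> j < n1 \<longrightarrow>
        (case p of (k, l) \<Rightarrow> g k l) (x1 i) (x1 j) = A i + B j + T i j) \<and> varies n1 T"
    using pair_homogeneous[OF finite_index_pairs N, of "\<lambda>(k, l). g k l"] by blast
  from bchoice[OF ex] obtain A where
    "\<forall>p\<in>?K. \<exists>B T. (\<forall>i j. i < j \<and> j < n1 \<longrightarrow>
        (case p of (k, l) \<Rightarrow> g k l) (x1 i) (x1 j) = A p i + B j + T i j) \<and> varies n1 T" by blast
  from bchoice[OF this] obtain B where
    "\<forall>p\<in>?K. \<exists>T. (\<forall>i j. i < j \<and> j < n1 \<longrightarrow>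
        (case p of (k, l) \<Rightarrow> g k l) (x1 i) (x1 j) = A p i + B p j + T i j) \<and> varies n1 T" by blast
  from bchoice[OF this] obtain T where
    T: "\<forall>p\<in>?K. (\<forall>i j. i < j \<and> j < n1 \<longrightarrow>
        (case p of (k, l) \<Rightarrow> g k l) (x1 i) (x1 j) = A p i + B p j + T p i j) \<and> varies n1 (T p)" by blast
  have g: "g k l (x1 i) (x1 j) = A (k, l) i + B (k, l) j + T (k, l) i j"
    if "(k, l) \<in> ?K" "i < j" "j < n1" for k l i j using T that by fastforce
  have varT: "varies n1 (T p)" if "p \<in> ?K" for p using T that by blast
  \<comment> \<open>The merging has to precede the choice of \<open>x2\<close>, since it is the
    merged one-variable functions that must become homogeneous.\<close>
  define h' where "h' k i = h k (x1 i) + (\<Sum>p\<in>{p\<in>?K. fst p = k}. A p i) + (\<Sum>p\<in>{p\<in>?K. snd p = k}. B p i)" for k i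
  have n1': "ramsey_bound (2 ^ (card {..<r} * 2 * 4)) 2 (L * n3 + 3) \<le> n1" by (simp add: n1)
  obtain x2 where x2: "strict_mono_on {..<L * n3} x2" "x2 ` {..<L * n3} \<subseteq> {..<n1}"
    and ex2: "\<forall>k\<in>{..<r}. \<exists>a. \<forall>i j. i < j \<and> j < L * n3 \<longrightarrow>
      2 ^ (j - i) * \<bar>h' k (x2 i) - a\<bar> \<le> \<bar>h' k (x2 j) - a\<bar> \<or>
      2 ^ (j - i) * \<bar>h' k (x2 j) - a\<bar> \<le> \<bar>h' k (x2 i) - a\<bar>"
    using single_homogeneous[OF finite_lessThan n1', of h'] by blast
  from bchoice[OF ex2] obtain a where
    a: "\<forall>k\<in>{..<r}. \<forall>i j. i < j \<and> j < L * n3 \<longrightarrow>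
      2 ^ (j - i) * \<bar>h' k (x2 i) - a k\<bar> \<le> \<bar>h' k (x2 j) - a k\<bar> \<or>
      2 ^ (j - i) * \<bar>h' k (x2 j) - a k\<bar> \<le> \<bar>h' k (x2 i) - a k\<bar>" by blast
  define z where "z i = x2 (L * i)" for i
  have Lmul: "L * i + L \<le> L * j" if "i < j" for i j
    using mult_le_mono2[OF Suc_leI[OF that], of L] by simp
  have Ln: "L * i < L * n3" if "i < n3" for i using that L(2) by simp
  have z_gap: "z i + L \<le> z j" if "i < j" "j < n3" for i j
    using strict_mono_on_gap[OF x2(1) _ Ln[OF that(2)], of "L * i"] Lmul[OF that(1)]
    unfolding z_def by linarith
  have z_lt: "z i < n1" if "i < n3" for i
    using subsetD[OF x2(2) imageI, of "L * i"] Ln[OF that] by (simp add: z_def)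
  \<comment> \<open>Each one-variable term is reduced by its pivot \<open>a k\<close>; the constant
    term takes the pivots back, so the total is unchanged.\<close>
  define \<mu> where "\<mu> p t = (case p of (k, l) \<Rightarrow>
      if k = r then c + sum a {..<r} else if k = l then h' k (z (t k)) - a k else T (k, l) (z (t k)) (z (t l)))"
    for p and t :: "nat \<Rightarrow> nat"
  \<comment> \<open>\<open>(r, r)\<close> indexes the constant term, \<open>(k, k)\<close> the one-variable term in position \<open>k\<close>.\<close>
  define supp where "supp p = {fst p, snd p} - {r}" for p :: "nat \<times> nat"
  have finI: "finite I" by (simp add: I)
  have I_cases: "p = (r, r) \<or> p \<in> ?K \<or> (\<exists>k<r. p = (k, k))" if "p \<in> I" for p
    using that by (auto simp: I)
  have strong: "\<mu> p t = 0 \<or> \<mu> p (t(k := v)) = 0 \<or>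
      real (card I) ^ 2 * \<bar>\<mu> p t\<bar> < \<bar>\<mu> p (t(k := v))\<bar> \<or> real (card I) ^ 2 * \<bar>\<mu> p (t(k := v))\<bar> < \<bar>\<mu> p t\<bar>"
    if p: "p \<in> I" and k: "k \<in> supp p" and v: "t k < v"
      and t: "incr_tuple r {..<n3} t" "incr_tuple r {..<n3} (t(k := v))" for p k t v
  proof -
    have "\<mu> p t = 0 \<or> \<mu> p (t(k := v)) = 0 \<or>
      (\<exists>d\<ge>L. 2 ^ d * \<bar>\<mu> p t\<bar> \<le> 2 * \<bar>\<mu> p (t(k := v))\<bar> \<or> 2 ^ d * \<bar>\<mu> p (t(k := v))\<bar> \<le> 2 * \<bar>\<mu> p t\<bar>)"
    proof -
      have kr: "k < r" using I_cases[OF p] k by (auto simp: supp_def index_pairs_def)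
      have vn: "v < n3" using t(2) kr by (auto simp: incr_tuple_def split: if_splits)
      consider "p = (k, k)" | l where "p = (k, l)" "k < l" "l < r" | l where "p = (l, k)" "l < k"
        using I_cases[OF p] k by (auto simp: supp_def index_pairs_def)
      then show ?thesis
      proof cases
        \<comment> \<open>The one-variable estimate measures gaps in the indices of
          \<open>x2\<close>, the pair estimate in its values; multiples of \<open>L\<close> give
          gaps of at least \<open>L\<close> in both.\<close>
        case 1
        have *: "2 ^ (L * v - L * t k) * \<bar>\<mu> p t\<bar> \<le> \<bar>\<mu> p (t(k := v))\<bar> \<or>
            2 ^ (L * v - L * t k) * \<bar>\<mu> p (t(k := v))\<bar> \<le> \<bar>\<mu> p t\<bar>"
          using bspec[OF a, of k] kr 1 v Ln[OF vn] L(2) by (simp add: \<mu>_def z_def)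
        have "2 ^ (L * v - L * t k) * \<bar>\<mu> p t\<bar> \<le> 2 * \<bar>\<mu> p (t(k := v))\<bar> \<or>
            2 ^ (L * v - L * t k) * \<bar>\<mu> p (t(k := v))\<bar> \<le> 2 * \<bar>\<mu> p t\<bar>"
          by (rule disj_forward[OF *]; rule order_trans, assumption, simp)
        moreover have "L * v - L * t k \<ge> L" using Lmul[OF v] by linarith
        ultimately show ?thesis by blast
      next
        case (2 l)
        have vl: "v < t l" using incr_tuple_less[OF t(2) 2(2,3)] 2(2) by simp
        have ln: "t l < n3" using t(1) 2(3) by (auto simp: incr_tuple_def)
        have gap: "z (t k) + L \<le> z v" "z v + L \<le> z (t l)"
          using z_gap[OF v vn] z_gap[OF vl ln] by auto
        have "varies n1 (T (k, l))" using 2 by (intro varT) (auto simp: index_pairs_def)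
        then have "2 ^ (z v - z (t k)) * \<bar>\<mu> p t\<bar> \<le> 2 * \<bar>\<mu> p (t(k := v))\<bar> \<or>
            2 ^ (z v - z (t k)) * \<bar>\<mu> p (t(k := v))\<bar> \<le> 2 * \<bar>\<mu> p t\<bar>"
          using 2 kr gap z_lt[OF ln] L(2) unfolding varies_def by (simp add: \<mu>_def)
        moreover have "z v - z (t k) \<ge> L" using gap by linarith
        ultimately show ?thesis by blast
      next
        case (3 l)
        have lk: "t l < t k" using incr_tuple_less[OF t(1) 3(2) kr] .
        have kn: "t k < n3" using v vn by simp
        have gap: "z (t l) + L \<le> z (t k)" "z (t k) + L \<le> z v"
          using z_gap[OF lk kn] z_gap[OF v vn] by auto
        have "varies n1 (T (l, k))" using 3 kr by (intro varT) (auto simp: index_pairs_def)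
        then have "2 ^ (z v - z (t k)) * \<bar>\<mu> p t\<bar> \<le> 2 * \<bar>\<mu> p (t(k := v))\<bar> \<or>
            2 ^ (z v - z (t k)) * \<bar>\<mu> p (t(k := v))\<bar> \<le> 2 * \<bar>\<mu> p t\<bar>"
          using 3 kr gap z_lt[OF vn] L(2) unfolding varies_def by (simp add: \<mu>_def)
        moreover have "z v - z (t k) \<ge> L" using gap by linarith
        ultimately show ?thesis by blast
      qed
    qed
    then show ?thesis using doubling_gap[OF _ _ _ L(1)] by blast
  qed
  have loc: "\<mu> p t = \<mu> p t'" if "p \<in> I" "\<And>k. k \<in> supp p \<Longrightarrow> t k = t' k" for p t t'
    using I_cases[OF that(1)] that(2) by (auto simp: \<mu>_def supp_def index_pairs_def)
  have supp_sub: "supp p \<subseteq> {..<r}" if "p \<in> I" for p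
    using I_cases[OF that] by (auto simp: supp_def index_pairs_def)
  have supp_card: "card (supp p) \<le> 2" for p
  proof -
    have "card (supp p) \<le> card {fst p, snd p}" unfolding supp_def by (intro card_mono) auto
    also have "\<dots> \<le> 2" by (simp add: card_insert_if)
    finally show ?thesis .
  qed
  have supp_inj: "inj_on supp I"
  proof (rule inj_onI)
    fix p q assume pq: "p \<in> I" "q \<in> I" and eq: "supp p = supp q"
    have "p = (if supp p = {} then (r, r) else (Min (supp p), Max (supp p)))" if "p \<in> I" for p
      using I_cases[OF that] by (auto simp: supp_def index_pairs_def insert_Diff_if)
    from this[OF pq(1)] this[OF pq(2)] show "p = q" unfolding eq by simp
  qed
  have "\<exists>x. strict_mono_on {..<n} x \<and> x ` {..<n} \<subseteq> {..<n3} \<and>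
    (\<forall>t t'. incr_tuple r {..<n} t \<and> incr_tuple r {..<n} t' \<longrightarrow>
      sgn (\<Sum>p\<in>I. \<mu> p (x \<circ> t)) = sgn (\<Sum>p\<in>I. \<mu> p (x \<circ> t')))"
  proof (rule dominance_homogeneous)
    show "\<mu> p t = \<mu> p t'" if "p \<in> I" "\<And>k. k \<in> supp p \<Longrightarrow> t k = t' k" for p t t'
      using that by (rule loc)
    show "\<mu> p t = 0 \<or> \<mu> p (t(k := v)) = 0 \<or>
        real (card I) ^ 2 * \<bar>\<mu> p t\<bar> < \<bar>\<mu> p (t(k := v))\<bar> \<or>
        real (card I) ^ 2 * \<bar>\<mu> p (t(k := v))\<bar> < \<bar>\<mu> p t\<bar>"
      if "p \<in> I" "k \<in> supp p" "t k < v" "incr_tuple r {..<n3} t" "incr_tuple r {..<n3} (t(k := v))" for p k t v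
      using that by (rule strong)
    show "ramsey_bound (2 ^ (card I * card I * 15)) 3 (n + 2 * r + 5) \<le> n3" by (simp only: n3)
  qed (use finI supp_sub supp_card supp_inj in auto)
  then obtain x3 where x3: "strict_mono_on {..<n} x3" "x3 ` {..<n} \<subseteq> {..<n3}"
    and hom0: "\<forall>t t'. incr_tuple r {..<n} t \<and> incr_tuple r {..<n} t' \<longrightarrow>
      sgn (\<Sum>p\<in>I. \<mu> p (x3 \<circ> t)) = sgn (\<Sum>p\<in>I. \<mu> p (x3 \<circ> t'))"
    by (elim exE conjE) (rule that)
  have hom: "sgn (\<Sum>p\<in>I. \<mu> p (x3 \<circ> t)) = sgn (\<Sum>p\<in>I. \<mu> p (x3 \<circ> t'))"
    if "incr_tuple r {..<n} t" "incr_tuple r {..<n} t'" for t t'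
    using hom0[rule_format, of t t'] that by simp
  define x where "x = x1 \<circ> z \<circ> x3"
  have F_eq: "F (x \<circ> t) = (\<Sum>p\<in>I. \<mu> p (x3 \<circ> t))" if t: "incr_tuple r {..<n} t" for t
  proof -
    define u where "u = z \<circ> x3 \<circ> t"
    have u_less: "u k < u l \<and> u l < n1" if "k < l" "l < r" for k l
    proof -
      have "t k < t l" "t l < n" using incr_tuple_less[OF t that] t that by (auto simp: incr_tuple_def)
      then have "x3 (t k) < x3 (t l)" "x3 (t l) < n3" using x3 by (auto simp: strict_mono_on_def)
      then show ?thesis using z_gap[of "x3 (t k)" "x3 (t l)"] z_lt L(2) by (simp add: u_def)
    qed
    have "(\<Sum>(k, l)\<in>?K. g k l (x1 (u k)) (x1 (u l))) =
        (\<Sum>p\<in>?K. A p (u (fst p)) + B p (u (snd p)) + T p (u (fst p)) (u (snd p)))"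
      using g u_less by (intro sum.cong) (auto simp: index_pairs_def)
    also have "\<dots> = (\<Sum>p\<in>?K. A p (u (fst p))) + (\<Sum>p\<in>?K. B p (u (snd p))) + (\<Sum>p\<in>?K. T p (u (fst p)) (u (snd p)))"
      by (simp add: sum.distrib)
    also have "(\<Sum>p\<in>?K. A p (u (fst p))) = (\<Sum>k<r. \<Sum>p\<in>{p\<in>?K. fst p = k}. A p (u (fst p)))"
      by (intro sum.group[symmetric] finite_index_pairs finite_lessThan) (auto simp: index_pairs_def)
    also have "\<dots> = (\<Sum>k<r. \<Sum>p\<in>{p\<in>?K. fst p = k}. A p (u k))" by simp
    also have "(\<Sum>p\<in>?K. B p (u (snd p))) = (\<Sum>k<r. \<Sum>p\<in>{p\<in>?K. snd p = k}. B p (u (snd p)))"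
      by (intro sum.group[symmetric] finite_index_pairs finite_lessThan) (auto simp: index_pairs_def)
    also have "\<dots> = (\<Sum>k<r. \<Sum>p\<in>{p\<in>?K. snd p = k}. B p (u k))" by simp
    finally have "F (x1 \<circ> u) = (\<Sum>p\<in>?K. T p (u (fst p)) (u (snd p))) + (\<Sum>k<r. h' k (u k)) + c"
      by (simp add: F_def h'_def sum.distrib)
    moreover have "(\<Sum>p\<in>I. \<mu> p (x3 \<circ> t)) = \<mu> (r, r) (x3 \<circ> t) + (\<Sum>p\<in>?K \<union> (\<lambda>k. (k, k)) ` {..<r}. \<mu> p (x3 \<circ> t))"
      unfolding I by (intro sum.insert finite_UnI finite_index_pairs finite_imageI finite_lessThan) (auto simp: index_pairs_def)
    moreover have "(\<Sum>p\<in>?K \<union> (\<lambda>k. (k, k)) ` {..<r}. \<mu> p (x3 \<circ> t)) =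
        (\<Sum>p\<in>?K. \<mu> p (x3 \<circ> t)) + (\<Sum>p\<in>(\<lambda>k. (k, k)) ` {..<r}. \<mu> p (x3 \<circ> t))"
      by (intro sum.union_disjoint finite_index_pairs finite_imageI finite_lessThan) (auto simp: index_pairs_def)
    moreover have "(\<Sum>p\<in>(\<lambda>k. (k, k)) ` {..<r}. \<mu> p (x3 \<circ> t)) = (\<Sum>k<r. \<mu> (k, k) (x3 \<circ> t))"
      by (subst sum.reindex) (auto simp: inj_on_def)
    moreover have "\<dots> = (\<Sum>k<r. h' k (u k)) - sum a {..<r}"
      by (simp add: \<mu>_def u_def flip: sum_subtractf)
    moreover have "(\<Sum>p\<in>?K. \<mu> p (x3 \<circ> t)) = (\<Sum>p\<in>?K. T p (u (fst p)) (u (snd p)))"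
      by (intro sum.cong) (auto simp: \<mu>_def u_def index_pairs_def)
    moreover have "\<mu> (r, r) (x3 \<circ> t) = c + sum a {..<r}" by (simp add: \<mu>_def)
    ultimately show ?thesis by (simp add: x_def u_def comp_assoc)
  qed
  have x_lt: "x i < x j" if "i < j" "j < n" for i j
  proof -
    have "x3 i < x3 j" "x3 j < n3" using that x3 by (auto simp: strict_mono_on_def)
    then have "z (x3 i) < z (x3 j)" "z (x3 j) < n1" using z_gap[of "x3 i" "x3 j"] z_lt L(2) by auto
    then show ?thesis using x1(1) by (auto simp: strict_mono_on_def x_def)
  qed
  have "x i < N" if "i < n" for i
    using that x3(2) z_lt x1(2) by (auto simp: x_def)
  then show ?thesis using x_lt hom F_eq by (intro exI[of _ x]) (auto simp: strict_mono_on_def)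
qed

section \<open>The tower height, and the passage from the hypergraph to sums of pair terms\<close>

lemma tower_bounded_three_stage:
  "tower_bounded 12 (\<lambda>n. ramsey_bound q1 4 (ramsey_bound q2 2 (L * ramsey_bound q3 3 (n + a) + 3) + 5))"
proof -
  have eqs: "Suc 1 + 3 = Suc 4" "Suc 4 + 2 = Suc 6" "Suc (Suc 6 + 4) = 12" by simp_all
  have "tower_bounded 1 (\<lambda>n. n)"
    unfolding tower_bounded_def by (intro exI[of _ 1]) simp
  then have "tower_bounded 1 (\<lambda>n. 1 * n + a)" by (rule tower_bounded_linear)
  then have "tower_bounded (Suc 1) (\<lambda>n. 1 * n + a)" by (rule tower_bounded_Suc) simp
  then have "tower_bounded (Suc 1) (\<lambda>n. n + a)" by (simp only: mult_1)
  then have "tower_bounded (Suc 1 + 3) (\<lambda>n. ramsey_bound q3 3 (n + a))"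
    by (rule tower_bounded_ramsey_bound) simp
  then have "tower_bounded (Suc 4) (\<lambda>n. L * ramsey_bound q3 3 (n + a) + 3)"
    unfolding eqs by (rule tower_bounded_linear)
  then have "tower_bounded (Suc 4 + 2) (\<lambda>n. ramsey_bound q2 2 (L * ramsey_bound q3 3 (n + a) + 3))"
    by (rule tower_bounded_ramsey_bound) simp
  then have "tower_bounded (Suc 6) (\<lambda>n. 1 * ramsey_bound q2 2 (L * ramsey_bound q3 3 (n + a) + 3) + 5)"
    unfolding eqs by (rule tower_bounded_linear)
  then have "tower_bounded (Suc 6 + 4) (\<lambda>n. ramsey_bound q1 4 (1 * ramsey_bound q2 2 (L * ramsey_bound q3 3 (n + a) + 3) + 5))"
    by (rule tower_bounded_ramsey_bound) simp
  \<comment> \<open>The bound so far has height 11; one more exponential brings it to the 12 of the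
    theorem.\<close>
  then have "tower_bounded (Suc (Suc 6 + 4)) (\<lambda>n. ramsey_bound q1 4 (1 * ramsey_bound q2 2 (L * ramsey_bound q3 3 (n + a) + 3) + 5))"
    by (rule tower_bounded_Suc) simp
  then show ?thesis by (simp only: eqs mult_1)
qed

text \<open>Collecting monomials by the two points involved hides the coordinates. Blocks
  \<open>(k, l)\<close> and \<open>(l, k)\<close> merge into one pair term, while diagonal blocks
  join the linear part as one-variable terms.\<close>

lemma quad_poly_pair_sum:
  fixes A :: "nat \<Rightarrow> nat \<Rightarrow> nat \<Rightarrow> nat \<Rightarrow> real" and d :: nat
  defines "q \<equiv> \<lambda>k l u v. \<Sum>j<d. \<Sum>j'<d. A k j l j' * u j * v j'"
  shows "quad_poly d r A B c z =
    (\<Sum>(k, l)\<in>index_pairs r. q k l (z k) (z l) + q l k (z l) (z k)) +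
    (\<Sum>k<r. q k k (z k) (z k) + (\<Sum>j<d. B k j * z k j)) + c"
proof -
  have "(\<Sum>k<r. \<Sum>j<d. \<Sum>l<r. \<Sum>j'<d. A k j l j' * z k j * z l j') = (\<Sum>k<r. \<Sum>l<r. q k l (z k) (z l))"
    unfolding q_def by (intro sum.cong refl sum.swap)
  then show ?thesis
    unfolding quad_poly_def by (simp add: sum_square_index_pairs sum.distrib)
qed

text \<open>If both fail, \<open>S\<close> contains a non-edge and an edge of size \<open>r\<close>.
  The sorted enumeration of the former and the tuple witnessing the latter give different values of
  \<open>\<Gamma>\<close>, although its argument is constant on \<open>S\<close>.\<close>

lemma clique_or_indep_if_constant:
  assumes "S \<subseteq> {..<N}"
    and const: "\<And>t t'. incr_tuple r S t \<Longrightarrow> incr_tuple r S t' \<Longrightarrow>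
      (quad_poly d r A B c (\<lambda>k j. p (t k) j) \<le> 0) = (quad_poly d r A B c (\<lambda>k j. p (t' k) j) \<le> 0)"
  shows "is_clique r (sa_edges d r N p A B c \<Gamma>) S \<or> is_indep r (sa_edges d r N p A B c \<Gamma>) S"
proof (rule ccontr)
  assume neg: "\<not> ?thesis"
  let ?edge = "\<lambda>t. \<Gamma> (quad_poly d r A B c (\<lambda>k j. p (t k) j) \<le> 0)"
  from neg obtain e e' where e: "e \<subseteq> S" "card e = r" "e \<notin> sa_edges d r N p A B c \<Gamma>"
    and e': "e' \<subseteq> S" "e' \<in> sa_edges d r N p A B c \<Gamma>"
    unfolding is_clique_def is_indep_def by blast
  have finS: "finite S" using assms(1) finite_subset by blast
  then have fine: "finite e" using e(1) finite_subset by blast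
  define t where "t = (!) (sorted_list_of_set e)"
  have len: "length (sorted_list_of_set e) = r" using e(2) by simp
  have te: "e = t ` {..<r}"
    using fine len nth_image[of r "sorted_list_of_set e"] by (simp add: t_def atLeast0LessThan flip: len)
  have "t k < t (Suc k)" if "Suc k < r" for k
    unfolding t_def using len that by (intro sorted_wrt_nth_less[OF strict_sorted_list_of_set]) auto
  then have t: "incr_tuple r S t" using te e(1) by (auto simp: incr_tuple_def)
  then have "incr_tuple r {..<N} t" using assms(1) by (auto simp: incr_tuple_def)
  then have "\<not> ?edge t" using e(3) te by (auto simp: sa_edges_def)
  moreover obtain t' where t': "incr_tuple r {..<N} t'" "e' = t' ` {..<r}" "?edge t'"
    using e'(2) by (auto simp: sa_edges_def)
  then have "incr_tuple r S t'" using e'(1) by (auto simp: incr_tuple_def)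
  ultimately show False using const[OF t, of t'] t'(3) by simp
qed

theorem theorem4p3:
  fixes r d :: nat
  assumes "r > 0" and "d > 0"
  shows "\<exists>C::real. C > 0 \<and>
    (\<forall>n::nat. n > 0 \<longrightarrow>
      (\<forall>(N::nat) (p :: nat \<Rightarrow> nat \<Rightarrow> real) A B c (\<Gamma> :: bool \<Rightarrow> bool).
         real N \<ge> tw 12 (C * real n)
         \<and> (\<forall>i<N. \<forall>i'<N. i \<noteq> i' \<longrightarrow> (\<exists>j<d. p i j \<noteq> p i' j))
         \<longrightarrow> (\<exists>S \<subseteq> {..<N}. card S = n \<and>
               (is_clique r (sa_edges d r N p A B c \<Gamma>) S
                \<or> is_indep r (sa_edges d r N p A B c \<Gamma>) S))))"
proof -
  let ?M = "card (insert (r, r) (index_pairs r \<union> (\<lambda>k. (k, k)) ` {..<r}))"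
  obtain L0 where "2 * real ?M ^ 2 < 2 ^ L0" using real_arch_pow[of 2] by auto
  then have L: "2 * real ?M ^ 2 < 2 ^ (L0 + 2)" by (rule less_le_trans) (simp add: power_increasing)
  define f where "f n = ramsey_bound (2 ^ (card (index_pairs r) * 3 * 6)) 4 (ramsey_bound (2 ^ (r * 2 * 4)) 2
      ((L0 + 2) * ramsey_bound (2 ^ (?M * ?M * 15)) 3 (n + (2 * r + 5)) + 3) + 5)" for n
  have "tower_bounded 12 f" unfolding f_def by (rule tower_bounded_three_stage)
  then obtain C where C: "C > 0" "\<And>n. n > 0 \<Longrightarrow> real (f n) \<le> tw 12 (real (C * n))"
    by (auto simp: tower_bounded_def)
  have "\<exists>S \<subseteq> {..<N}. card S = n \<and>
      (is_clique r (sa_edges d r N p A B c \<Gamma>) S \<or> is_indep r (sa_edges d r N p A B c \<Gamma>) S)"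
    if n: "n > 0" and N: "real N \<ge> tw 12 (real C * real n)" for n N p A B c \<Gamma>
  proof -
    define q where "q k l u v = (\<Sum>j<d. \<Sum>j'<d. A k j l j' * u j * v j')" for k l and u v :: "nat \<Rightarrow> real"
    have poly: "quad_poly d r A B c (\<lambda>k j. p (t k) j) =
        (\<Sum>(k, l)\<in>index_pairs r. q k l (p (t k)) (p (t l)) + q l k (p (t l)) (p (t k))) +
        (\<Sum>k<r. q k k (p (t k)) (p (t k)) + (\<Sum>j<d. B k j * p (t k) j)) + c" for t
      unfolding q_def by (rule quad_poly_pair_sum)
    have "f n \<le> N" using C(2)[OF n] N by simp
    then have N': "ramsey_bound (2 ^ (card (index_pairs r) * 3 * 6)) 4 (ramsey_bound (2 ^ (r * 2 * 4)) 2
      ((L0 + 2) * ramsey_bound (2 ^ (?M * ?M * 15)) 3 (n + 2 * r + 5) + 3) + 5) \<le> N"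
      by (simp only: f_def add.assoc)
    have "\<exists>x. strict_mono_on {..<n} x \<and> x ` {..<n} \<subseteq> {..<N} \<and>
      (\<forall>t t'. incr_tuple r {..<n} t \<and> incr_tuple r {..<n} t' \<longrightarrow>
        sgn (quad_poly d r A B c (\<lambda>k j. p ((x \<circ> t) k) j)) = sgn (quad_poly d r A B c (\<lambda>k j. p ((x \<circ> t') k) j)))"
      unfolding poly
      by (rule pair_sum_homogeneous[OF refl L _ refl refl N', where
            g = "\<lambda>k l i j. q k l (p i) (p j) + q l k (p j) (p i)" and
            h = "\<lambda>k i. q k k (p i) (p i) + (\<Sum>j<d. B k j * p i j)"]) simp
    then obtain x where x: "strict_mono_on {..<n} x" "x ` {..<n} \<subseteq> {..<N}"
      and hom0: "\<forall>t t'. incr_tuple r {..<n} t \<and> incr_tuple r {..<n} t' \<longrightarrow>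
        sgn (quad_poly d r A B c (\<lambda>k j. p ((x \<circ> t) k) j)) = sgn (quad_poly d r A B c (\<lambda>k j. p ((x \<circ> t') k) j))"
      by (elim exE conjE) (rule that)
    note hom = hom0[rule_format, OF conjI]
    have lift: "\<exists>s. incr_tuple r {..<n} s \<and> (\<forall>k<r. t k = x (s k))" if t: "incr_tuple r (x ` {..<n}) t" for t
    proof -
      have "\<forall>k\<in>{..<r}. \<exists>i. i < n \<and> t k = x i" using t by (auto simp: incr_tuple_def)
      from bchoice[OF this] obtain s where s: "\<forall>k\<in>{..<r}. s k < n \<and> t k = x (s k)" by blast
      have "s k < s (Suc k)" if "Suc k < r" for k
      proof -
        have "x (s k) < x (s (Suc k))" "s k < n" "s (Suc k) < n"
          using t s that by (auto simp: incr_tuple_def)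
        then show ?thesis using strict_mono_on_less[OF x(1)] by simp
      qed
      then show ?thesis using s by (auto simp: incr_tuple_def)
    qed
    have sgn_le: "sgn a = sgn b \<Longrightarrow> (a \<le> 0) = (b \<le> 0)" for a b :: real
      by (auto simp: sgn_if split: if_splits)
    \<comment> \<open>A tuple in the range of \<open>x\<close> factors through \<open>x\<close> at
      positions below \<open>r\<close> only, and the polynomial reads no others.\<close>
    have cong: "quad_poly d r A B c (\<lambda>k j. p (t k) j) = quad_poly d r A B c (\<lambda>k j. p ((x \<circ> s) k) j)"
      if "\<forall>k<r. t k = x (s k)" for t s
      using that unfolding quad_poly_def by (simp cong: sum.cong_simp)
    have "is_clique r (sa_edges d r N p A B c \<Gamma>) (x ` {..<n}) \<or> is_indep r (sa_edges d r N p A B c \<Gamma>) (x ` {..<n})"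
    proof (rule clique_or_indep_if_constant[OF x(2)])
      fix t t' assume "incr_tuple r (x ` {..<n}) t" "incr_tuple r (x ` {..<n}) t'"
      from lift[OF this(1)] lift[OF this(2)] obtain s s' where
        s: "incr_tuple r {..<n} s" "\<forall>k<r. t k = x (s k)" and
        s': "incr_tuple r {..<n} s'" "\<forall>k<r. t' k = x (s' k)"
        by (elim exE conjE) (rule that)
      show "(quad_poly d r A B c (\<lambda>k j. p (t k) j) \<le> 0) = (quad_poly d r A B c (\<lambda>k j. p (t' k) j) \<le> 0)"
        unfolding cong[of t s, OF s(2)] cong[of t' s', OF s'(2)]
        by (rule sgn_le[OF hom[OF s(1) s'(1)]])
    qed
    moreover have "card (x ` {..<n}) = n"
      using strict_mono_on_imp_inj_on[OF x(1)] by (simp add: card_image)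
    ultimately show ?thesis using x(2) by (intro exI[of _ "x ` {..<n}"] conjI)
  qed
  then show ?thesis using C(1) by (intro exI[of _ "real C"]) auto
qed

end
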